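(* If $\mathcal{T}$ is any well-founded $B$-tree on any set, and if $(\mathcal{C}^0_t,\mathcal{C}^1_t)_{t\in\mathcal{T}}$ is any coloring of $\mathcal{T}$, then for $j\in\{0,1\}$ there exist an ordinal $\xi_j$ and an extended order preserving map $(i_j,e_j)$ of $\mathcal{T}_{\xi_j}$ into $\mathcal{T}$ so that the induced coloring on $\mathcal{T}_{\xi_j}$ is monochromatically $j$. Moreover, $\xi_0,\xi_1$ can be chosen so that $\xi_0\oplus\xi_1=o(\mathcal{T})$.
   Context: For finite sequences, $|s|$ is the length of $s$, $s|_n$ the initial segment of length $n$, $s^\frown t$ concatenation, and $s\prec t$ means $s$ is a proper initial segment of $t$ ($s\preceq t$ allows equality). A tree is a set of finite sequences closed under initial segments; a $B$-tree is a set $T$ of non-empty finite sequences with $T\cup\{\varnothing\}$ a tree. $MAX(T)$ is the set of $\prec$-maximal members of $T$, $T'=T\setminus MAX(T)$, $d^0(T)=T$, $d^{\xi+1}(T)=(d^\xi(T))'$, $d^\xi(T)=\bigcap_{\zeta<\xi}d^\zeta(T)$ for limit $\xi$. $T$ is well-founded if $d^\xi(T)=\varnothing$ for some ordinal $\xi$, and then $o(T)$ is the least such $\xi$. A map $i$ between $B$-trees is order preserving if $s\prec t$ implies $i(s)\prec i(t)$. Minimal trees: $\mathcal{MT}_0=\{\varnothing\}$, $\mathcal{MT}_{\xi+1}=\{\varnothing\}\cup\{(\xi+1)^\frown t:t\in\mathcal{MT}_\xi\}$, $\mathcal{MT}_\xi=\bigcup_{\zeta<\xi}\mathcal{MT}_{\zeta+1}$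 for limit $\xi$, and $\mathcal{T}_\xi=\mathcal{MT}_\xi\setminus\{\varnothing\}$. For a well-founded $B$-tree $\mathcal{T}$ and $t\in\mathcal{T}$, $\mathcal{E}_t(\mathcal{T})=\{s\in MAX(\mathcal{T}):t\preceq s\}$. A coloring of $\mathcal{T}$ is a family $(\mathcal{C}^0_t,\mathcal{C}^1_t)_{t\in\mathcal{T}}$ with $\mathcal{E}_t(\mathcal{T})=\mathcal{C}^0_t\cup\mathcal{C}^1_t$ for each $t\in\mathcal{T}$. It is monochromatically $j$ if for each $t\in MAX(\mathcal{T})$, $t\in\bigcap_{i=1}^{|t|}\mathcal{C}^j_{t|_i}$. For well-founded $B$-trees $\mathcal{T},\mathcal{W}$, an extended order preserving map of $\mathcal{T}$ into $\mathcal{W}$ is a pair $(i,e)$ with $i:\mathcal{T}\to\mathcal{W}$ order preserving, $e:MAX(\mathcal{T})\to MAX(\mathcal{W})$, and $i(t)\preceq e(t)$ for each $t\in MAX(\mathcal{T})$. Given a coloring $(\mathcal{C}^0_w,\mathcal{C}^1_w)_{w\in\mathcal{W}}$ of $\mathcal{W}$, the induced coloring $(\mathcal{D}^0_t,\mathcal{D}^1_t)_{t\in\mathcal{T}}$ of $\mathcal{T}$ is $\mathcal{D}^j_t=\{s\in\mathcal{E}_t(\mathcal{T}):e(s)\in\mathcal{C}^j_{i(t)}\}$. If $\xi_j=0$, $i_j$ and $e_j$ are the empty maps, and the (empty) induced coloring is regarded as monochromatically $j$ for both $j=0$ and $j=1$. Hessenberg (natural) sum: writing $\xi=\omega^{\alpha_1}m_1+\ldots+\omega^{\alpha_k}m_k$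 and $\zeta=\omega^{\alpha_1}n_1+\ldots+\omega^{\alpha_k}n_k$ with $\alpha_1>\ldots>\alpha_k$ and $m_i,n_i$ non-negative integers, $\xi\oplus\zeta=\omega^{\alpha_1}(m_1+n_1)+\ldots+\omega^{\alpha_k}(m_k+n_k)$. *)

theory Defs
  imports Main "HOL-Library.Sublist"
begin

(* Ordinals.

   'a ordinal is the type of order types of well-orders whose field is a set of lists over 'a,
   i.e. of all ordinals of cardinality at most that of 'a list.  As 'a list is infinite, these are
   exactly the ordinals below the successor cardinal of 'a list; they are closed under suprema of
   families of size at most that of 'a list, in particular under the operations below.  If T is a
   set of lists over 'a, the transfinite sequence of its derivatives loses at least one element of
   T at every step until it becomes constant, so it becomes constant before that cardinal:
   nothing is lost by not having larger ordinals. *)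

unbundle cardinal_syntax

quotient_type 'a ordinal = "'a list rel" / partial: "\<lambda>r s. (r, s) \<in> ordIso"
proof (rule part_equivpI)
  show "\<exists>r :: 'a list rel. r =o r"
    using card_of_Well_order ordIso_reflexive by blast
  show "symp (\<lambda>r s :: 'a list rel. r =o s)"
    by (auto intro: sympI ordIso_symmetric)
  show "transp (\<lambda>r s :: 'a list rel. r =o s)"
    by (auto intro: transpI ordIso_transitive)
qed

lemma ordIso_self_iff: "r =o r \<longleftrightarrow> Well_order r"
  using ordIso_reflexive by (auto simp: ordIso_def)

lemma ordinal_exhaust:
  obtains r where "Well_order r" "x = abs_ordinal r"
  using Quotient_abs_rep[OF Quotient_ordinal, of x] Quotient_rep_reflp[OF Quotient_ordinal, of x]
  unfolding ordIso_self_iff by metis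

instantiation ordinal :: (type) linorder
begin

lift_definition less_eq_ordinal :: "'a ordinal \<Rightarrow> 'a ordinal \<Rightarrow> bool"
  is "\<lambda>r s. (r, s) \<in> ordLeq"
  by (meson ordIso_ordLeq_trans ordIso_symmetric ordLeq_ordIso_trans)

lift_definition less_ordinal :: "'a ordinal \<Rightarrow> 'a ordinal \<Rightarrow> bool"
  is "\<lambda>r s. (r, s) \<in> ordLess"
  by (meson ordIso_ordLess_trans ordIso_symmetric ordLess_ordIso_trans)

instance
proof
  fix x y z :: "'a ordinal"
  show "x < y \<longleftrightarrow> x \<le> y \<and> \<not> y \<le> x"
    by transfer (metis not_ordLeq_iff_ordLess ordIso_self_iff ordLess_imp_ordLeq)
  show "x \<le> x"
    by transfer (simp add: ordIso_self_iff ordLeq_reflexive)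
  show "x \<le> y \<Longrightarrow> y \<le> z \<Longrightarrow> x \<le> z"
    by transfer (rule ordLeq_transitive)
  show "x \<le> y \<Longrightarrow> y \<le> x \<Longrightarrow> x = y"
    by transfer (simp add: ordIso_iff_ordLeq)
  show "x \<le> y \<or> y \<le> x"
  proof -
    obtain r where r: "Well_order r" "x = abs_ordinal r" by (rule ordinal_exhaust)
    obtain s where s: "Well_order s" "y = abs_ordinal s" by (rule ordinal_exhaust)
    show ?thesis
      using ordLeq_total[OF r(1) s(1)] r s by (simp add: less_eq_ordinal.abs_eq ordIso_self_iff)
  qed
qed

end

instance ordinal :: (type) wellorder
proof
  fix P :: "'a ordinal \<Rightarrow> bool" and a
  assume step: "\<And>x. (\<And>y. y < x \<Longrightarrow> P y) \<Longrightarrow> P x"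
  have "P (abs_ordinal r)" if "Well_order r" for r
    using that
  proof (induction r rule: wf_induct_rule[OF wf_ordLess])
    case (1 r)
    show ?case
    proof (rule step)
      fix y assume *: "y < abs_ordinal r"
      obtain s where s: "Well_order s" "y = abs_ordinal s" by (rule ordinal_exhaust)
      with * 1 have "s <o r"
        by (simp add: less_ordinal.abs_eq ordIso_self_iff)
      with 1 s show "P y" by blast
    qed
  qed
  then show "P a"
    by (metis ordinal_exhaust)
qed

lemma Well_order_add_top:
  assumes r: "Well_order r" and t: "t \<notin> Field r"
  defines "r' \<equiv> r \<union> insert t (Field r) \<times> {t}"
  shows "Well_order r'" and "r <o r'"
proof -
  have F: "Field r' = insert t (Field r)"
    by (auto simp: r'_def Field_def)
  have rF: "a \<in> Field r" "b \<in> Field r" if "(a, b) \<in> r" for a b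
    using that by (auto simp: Field_def)
  have memb: "(a, b) \<in> r' \<longleftrightarrow> (a, b) \<in> r \<or> (b = t \<and> (a = t \<or> a \<in> Field r))" for a b
    by (auto simp: r'_def)
  have props: "Refl r" "trans r" "antisym r" "Total r" "wf (r - Id)"
    using r by (auto simp: order_on_defs)
  have "Refl r'" using props(1)
    by (simp add: refl_on_def F memb)
  moreover have "trans r'"
    unfolding trans_def memb using transD[OF props(2)] rF t by metis
  moreover have "antisym r'"
    unfolding antisym_def memb using antisymD[OF props(3)] rF t by metis
  moreover have "Total r'" using props(4)
    by (auto simp: total_on_def F memb)
  moreover have "wf (r' - Id)"
  proof -
    have "r' - Id = (r - Id) \<union> Field r \<times> {t}"
      using t rF by (auto simp: memb)
    moreover have "wf (Field r \<times> {t})"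
      unfolding wf_def using t by (metis SigmaE2 singletonD)
    moreover have "Domain (r - Id) \<inter> Range (Field r \<times> {t}) = {}"
      using t by (auto simp: Field_def)
    ultimately show ?thesis
      using props(5) by (simp add: wf_Un)
  qed
  ultimately show wo: "Well_order r'"
    by (auto simp: order_on_defs r'_def Field_def)
  have "underS r' t = Field r"
    using t rF by (auto simp: underS_def memb)
  moreover have "Restr r' (Field r) = r"
    using t rF by (auto simp: r'_def)
  ultimately show "r <o r'"
    using underS_Restr_ordLess[OF wo, of t] F by simp
qed

instance ordinal :: (type) no_top
proof
  fix a :: "'a ordinal"
  obtain r where r: "Well_order r" "a = abs_ordinal r" by (rule ordinal_exhaust)
  define s where "s = dir_image r (Cons undefined)"
  have inj: "inj_on (Cons undefined) (Field r)" by simp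
  have s: "Well_order s" "r =o s" "[] \<notin> Field s"
    using Well_order_dir_image[OF r(1) inj] dir_image_ordIso[OF r(1) inj]
    by (auto simp: s_def dir_image_Field)
  obtain r' :: "'a list rel" where "Well_order r'" "s <o r'"
    using Well_order_add_top[OF s(1,3)] by blast
  then have "a < abs_ordinal r'"
    using r s ordIso_ordLess_trans[of r s r'] by (simp add: less_ordinal.abs_eq ordIso_self_iff)
  then show "\<exists>b. a < b" ..
qed

instantiation ordinal :: (type) zero
begin
lift_definition zero_ordinal :: "'a ordinal" is "{}"
  by (simp add: ordIso_self_iff)
instance ..
end

lemma zero_le_ordinal [simp]: "(0 :: 'a ordinal) \<le> \<alpha>"
proof transfer
  fix r :: "'a list rel" assume "r =o r"
  then show "{} \<le>o r"
    by (auto simp: ordIso_self_iff ordLeq_def embed_def bij_betw_def)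
qed

unbundle no cardinal_syntax

definition osuc :: "'a ordinal \<Rightarrow> 'a ordinal" where
  "osuc \<alpha> = (LEAST \<beta>. \<alpha> < \<beta>)"

definition is_limit :: "'a ordinal \<Rightarrow> bool" where
  "is_limit \<xi> \<longleftrightarrow> \<xi> \<noteq> 0 \<and> (\<forall>\<zeta>. \<xi> \<noteq> osuc \<zeta>)"

lemma less_osuc [simp]: "\<alpha> < osuc \<alpha>"
  unfolding osuc_def using gt_ex by (rule LeastI_ex)

lemma osuc_le_iff: "osuc \<alpha> \<le> \<beta> \<longleftrightarrow> \<alpha> < \<beta>"
  using less_osuc order.strict_trans2 unfolding osuc_def by (blast intro: Least_le)

lemma osuc_inject [simp]: "osuc \<alpha> = osuc \<beta> \<longleftrightarrow> \<alpha> = \<beta>"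
  by (metis less_osuc linorder_neqE not_le osuc_le_iff)

lemma osuc_neq_zero [simp]: "osuc \<alpha> \<noteq> 0" "0 \<noteq> osuc \<alpha>"
  by (metis less_osuc not_le zero_le_ordinal)+

lemma osuc_less_limit: "is_limit \<xi> \<Longrightarrow> \<zeta> < \<xi> \<Longrightarrow> osuc \<zeta> < \<xi>"
  by (metis is_limit_def order.not_eq_order_implies_strict osuc_le_iff)

lemma not_limit [simp]: "\<not> is_limit 0" "\<not> is_limit (osuc \<xi>)"
  by (auto simp: is_limit_def)

lemma ordinal_cases:
  obtains "\<alpha> = 0" | \<beta> where "\<alpha> = osuc \<beta>" | "is_limit \<alpha>"
  by (auto simp: is_limit_def)

definition osup :: "'a ordinal set \<Rightarrow> 'a ordinal" where
  "osup A = (LEAST \<beta>. \<forall>\<alpha>\<in>A. \<alpha> \<le> \<beta>)"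

function oadd :: "'a ordinal \<Rightarrow> 'a ordinal \<Rightarrow> 'a ordinal" where
  "oadd \<alpha> 0 = \<alpha>"
| "oadd \<alpha> (osuc \<beta>) = osuc (oadd \<alpha> \<beta>)"
| "is_limit \<beta> \<Longrightarrow> oadd \<alpha> \<beta> = osup (oadd \<alpha> ` {..<\<beta>})"
  by (metis ordinal_cases surj_pair) auto
termination by (relation "inv_image {(x, y). x < y} snd") (auto intro: wf)

primrec omult_nat :: "'a ordinal \<Rightarrow> nat \<Rightarrow> 'a ordinal" where
  "omult_nat \<alpha> 0 = 0"
| "omult_nat \<alpha> (Suc n) = oadd (omult_nat \<alpha> n) \<alpha>"

function omega_pow :: "'a ordinal \<Rightarrow> 'a ordinal" where
  "omega_pow 0 = osuc 0"
| "omega_pow (osuc \<beta>) = osup (range (omult_nat (omega_pow \<beta>)))"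
| "is_limit \<beta> \<Longrightarrow> omega_pow \<beta> = osup (omega_pow ` {..<\<beta>})"
  by (metis ordinal_cases surj_pair) auto
termination by (relation "{(x, y). x < y}") (auto intro: wf)

(* For exponents \<alpha>\<^sub>1, ..., \<alpha>\<^sub>k and coefficients m \<alpha>\<^sub>1, ..., m \<alpha>\<^sub>k. *)
primrec cantor_sum :: "'a ordinal list \<Rightarrow> ('a ordinal \<Rightarrow> nat) \<Rightarrow> 'a ordinal" where
  "cantor_sum [] m = 0"
| "cantor_sum (\<alpha> # as) m = oadd (omult_nat (omega_pow \<alpha>) (m \<alpha>)) (cantor_sum as m)"

(* Hessenberg sum: two ordinals are written over the same decreasing exponents, with zero
   coefficients allowed; the result is unique by uniqueness of the Cantor normal form. *)
definition natural_sum :: "'a ordinal \<Rightarrow> 'a ordinal \<Rightarrow> 'a ordinal"  (infixl "\<oplus>" 65) where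
  "\<xi> \<oplus> \<zeta> = (THE \<eta>. \<exists>as m n. sorted_wrt (>) as
     \<and> \<xi> = cantor_sum as m \<and> \<zeta> = cantor_sum as n
     \<and> \<eta> = cantor_sum as (\<lambda>\<alpha>. m \<alpha> + n \<alpha>))"

definition is_tree :: "'a list set \<Rightarrow> bool" where
  "is_tree T \<longleftrightarrow> (\<forall>t\<in>T. \<forall>s. prefix s t \<longrightarrow> s \<in> T)"

definition B_tree :: "'a list set \<Rightarrow> bool" where
  "B_tree T \<longleftrightarrow> [] \<notin> T \<and> is_tree (insert [] T)"

definition leaves :: "'a list set \<Rightarrow> 'a list set" where
  "leaves T = {t \<in> T. \<not> (\<exists>s\<in>T. strict_prefix t s)}"

function deriv :: "'b ordinal \<Rightarrow> 'a list set \<Rightarrow> 'a list set" where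
  "deriv 0 T = T"
| "deriv (osuc \<xi>) T = deriv \<xi> T - leaves (deriv \<xi> T)"
| "is_limit \<xi> \<Longrightarrow> deriv \<xi> T = (\<Inter>\<zeta>\<in>{..<\<xi>}. deriv \<zeta> T)"
  by (metis ordinal_cases surj_pair) auto
termination by (relation "inv_image {(x, y). x < y} fst") (auto intro: wf)

definition wf_tree :: "'a list set \<Rightarrow> bool" where
  "wf_tree T \<longleftrightarrow> (\<exists>\<xi> :: 'a ordinal. deriv \<xi> T = {})"

definition tree_order :: "'a list set \<Rightarrow> 'a ordinal" where
  "tree_order T = (LEAST \<xi>. deriv \<xi> T = {})"

function MT :: "'a ordinal \<Rightarrow> 'a ordinal list set" where
  "MT 0 = {[]}"
| "MT (osuc \<xi>) = {[]} \<union> {osuc \<xi> # t | t. t \<in> MT \<xi>}"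
| "is_limit \<xi> \<Longrightarrow> MT \<xi> = (\<Union>\<zeta>\<in>{..<\<xi>}. MT (osuc \<zeta>))"
  by (metis ordinal_cases surj_pair) auto
termination by (relation "{(x, y). x < y}") (auto intro: wf osuc_less_limit)

definition min_tree :: "'a ordinal \<Rightarrow> 'a ordinal list set" where
  "min_tree \<xi> = MT \<xi> - {[]}"

definition ends :: "'a list set \<Rightarrow> 'a list \<Rightarrow> 'a list set" where
  "ends T t = {s \<in> leaves T. prefix t s}"

(* C j t is the class of colour j, for j in {0, 1}; other indices j are irrelevant. *)
definition coloring :: "'a list set \<Rightarrow> (nat \<Rightarrow> 'a list \<Rightarrow> 'a list set) \<Rightarrow> bool" where
  "coloring T C \<longleftrightarrow> (\<forall>t\<in>T. ends T t = C 0 t \<union> C 1 t)"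

definition monochromatic ::
  "'a list set \<Rightarrow> (nat \<Rightarrow> 'a list \<Rightarrow> 'a list set) \<Rightarrow> nat \<Rightarrow> bool" where
  "monochromatic T C j \<longleftrightarrow> (\<forall>t\<in>leaves T. t \<in> (\<Inter>i\<in>{1..length t}. C j (take i t)))"

definition order_preserving :: "'a list set \<Rightarrow> 'b list set \<Rightarrow> ('a list \<Rightarrow> 'b list) \<Rightarrow> bool" where
  "order_preserving S T i \<longleftrightarrow> i ` S \<subseteq> T
     \<and> (\<forall>s\<in>S. \<forall>t\<in>S. strict_prefix s t \<longrightarrow> strict_prefix (i s) (i t))"

definition ext_order_preserving ::
  "'a list set \<Rightarrow> 'b list set \<Rightarrow> ('a list \<Rightarrow> 'b list) \<Rightarrow> ('a list \<Rightarrow> 'b list) \<Rightarrow> bool" where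
  "ext_order_preserving S T i e \<longleftrightarrow> order_preserving S T i
     \<and> e ` leaves S \<subseteq> leaves T \<and> (\<forall>t\<in>leaves S. prefix (i t) (e t))"

definition induced_coloring ::
  "'a list set \<Rightarrow> ('a list \<Rightarrow> 'b list) \<Rightarrow> ('a list \<Rightarrow> 'b list) \<Rightarrow>
     (nat \<Rightarrow> 'b list \<Rightarrow> 'b list set) \<Rightarrow> nat \<Rightarrow> 'a list \<Rightarrow> 'a list set" where
  "induced_coloring S i e C j t = {s \<in> ends S t. e s \<in> C j (i t)}"

end

theory Submission
  imports Defs "HOL-Library.Multiset_Order"
begin

text \<open>
  For a set \<open>A\<close> of leaves of \<open>T\<close> and a colour \<open>j\<close>, a node \<open>t\<close> has a \<open>j\<close>-rank relative to \<open>A\<close>: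
  it is at least \<open>\<zeta> + 1\<close> if some proper extension \<open>u\<close> of \<open>t\<close> has \<open>j\<close>-rank at least \<open>\<zeta>\<close>
  relative to those leaves of \<open>A\<close> that have colour \<open>j\<close> at \<open>u\<close>, where at least one leaf must
  always survive. If the root has \<open>j\<close>-rank at least \<open>\<xi>\<close> relative to all leaves, then the
  minimal tree of order \<open>\<xi>\<close> maps into \<open>T\<close> monochromatically \<open>j\<close> (\<open>reach_embeds\<close>): the nodes
  \<open>u\<close> chosen along a branch are the values of \<open>i\<close>, and a surviving leaf is the value of \<open>e\<close>.
  With every leaf admitted at every node, the same recursion gives the ordinary rank, which at
  the root is the order of \<open>T\<close>.

  Two facts give the theorem. The ordinary rank is indivisible in the set of leaves
  (\<open>reach_split\<close>): if \<open>A\<close> is divided into two parts, the rank relative to one of them equals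
  the rank relative to \<open>A\<close>. Hence the sum of the two colour ranks is at least the ordinary
  rank (\<open>reach_colors\<close>). For, by induction, above a node \<open>u\<close> of ordinary rank \<open>\<zeta>\<close> one may keep
  just the leaves of one colour, say 0, at \<open>u\<close> without changing \<open>\<zeta>\<close>, and then the two colour
  ranks \<open>\<alpha>\<close>, \<open>\<beta>\<close> of \<open>u\<close> have natural sum at least \<open>\<zeta>\<close>; at a node below \<open>u\<close> the 0-rank is at
  least \<open>\<alpha> + 1\<close>, because \<open>u\<close> itself may be used, and the sum exceeds \<open>\<zeta>\<close> since the natural sum
  is strictly increasing.

  It remains to turn \<open>\<ge>\<close> into equality. Smaller ranks are also attained, so it suffices that
  any ordinal \<open>\<eta> \<le> \<xi> \<oplus> \<zeta>\<close> is itself a natural sum of ordinals at most \<open>\<xi>\<close> and \<open>\<zeta>\<close>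
  (\<open>natural_sum_exact\<close>). The facts about \<open>\<oplus>\<close> are read off from the Cantor normal form: it is
  an order isomorphism (\<open>cnf\<close>) from finite multisets of exponents, with the multiset order,
  onto the ordinals, and takes multiset union to the natural sum.
\<close>

section \<open>Suprema and sums of ordinals\<close>

unbundle cardinal_syntax

text \<open>
  An ordinal below the type of \<open>r\<close> is the type of a proper initial segment of \<open>r\<close>, and these
  segments are indexed by the field of \<open>r\<close>, a set of lists.
\<close>

lemma ordinal_below_small: "|{..<x :: 'a ordinal}| \<le>o |UNIV :: 'a list set|"
proof -
  obtain r where r: "Well_order r" "x = abs_ordinal r" by (rule ordinal_exhaust)
  have "{..<x} \<subseteq> (\<lambda>a. abs_ordinal (Restr r (underS r a))) ` Field r"
  proof
    fix y assume "y \<in> {..<x}"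
    obtain s where s: "Well_order s" "y = abs_ordinal s" by (rule ordinal_exhaust)
    with r \<open>y \<in> {..<x}\<close> have "s <o r"
      by (simp add: less_ordinal.abs_eq ordIso_self_iff)
    then obtain a where a: "a \<in> Field r" "s =o Restr r (underS r a)"
      using ordLess_iff_ordIso_Restr[OF r(1) s(1)] by blast
    then have "y = abs_ordinal (Restr r (underS r a))"
      using s Quotient_rel[OF Quotient_ordinal, of s "Restr r (underS r a)"]
        Well_order_Restr[OF r(1)] by (simp add: ordIso_self_iff)
    then show "y \<in> (\<lambda>a. abs_ordinal (Restr r (underS r a))) ` Field r" using a by blast
  qed
  then have "|{..<x}| \<le>o |Field r|"
    by (rule surj_imp_ordLeq)
  then show ?thesis
    using card_of_mono1[OF subset_UNIV] ordLeq_transitive by blast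
qed

text \<open>
  The Burali-Forti argument. If the ordinals could be indexed by lists, their own order would be
  the order type \<open>z\<close> of a relation on lists. Sending each ordinal to the type of its initial segment
  would then be a strictly increasing map of the ordinals into the ordinals below \<open>z\<close>; but a
  strictly increasing map of a well-order never moves a point down, not even \<open>z\<close>.
\<close>

lemma ordinals_large: "\<not> |UNIV :: 'a ordinal set| \<le>o |UNIV :: 'a list set|"
proof
  assume "|UNIV :: 'a ordinal set| \<le>o |UNIV :: 'a list set|"
  then obtain g :: "'a ordinal \<Rightarrow> 'a list" where g: "inj g"
    by (auto simp flip: card_of_ordLeq)
  define q where "q = {(x, y :: 'a ordinal). x \<le> y}"
  have Fq: "Field q = UNIV" by (auto simp: q_def Field_def)
  have "q - Id = {(x, y). x < y}" by (auto simp: q_def)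
  then have "wf (q - Id)" by (simp only: wf)
  moreover have "Linear_order q"
    unfolding order_on_defs Fq refl_on_def trans_def antisym_def total_on_def
    by (auto simp: q_def)
  ultimately have q: "Well_order q" by (simp only: well_order_on_def)
  define r where "r = dir_image q g"
  have Fr: "Field r = range g" by (simp add: r_def dir_image_Field Fq)
  have r: "Well_order r"
    unfolding r_def using q g by (intro Well_order_dir_image) (auto simp: Fq)
  have r_iff: "(g x, g y) \<in> r \<longleftrightarrow> x \<le> y" for x y
    using g by (auto simp: r_def dir_image_def q_def inj_def)
  have underS_eq: "underS r (g x) = g ` {..<x}" for x
  proof -
    have "underS r (g x) \<subseteq> range g" unfolding Fr[symmetric] by (auto simp: underS_def Field_def)
    then show ?thesis using g by (auto simp: underS_def r_iff inj_eq)
  qed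
  define z where "z = abs_ordinal r"
  define F where "F x = abs_ordinal (Restr r (underS r (g x)))" for x
  have below: "F x < z" for x
    using underS_Restr_ordLess[OF r, of "g x"] r Well_order_Restr[OF r] Fr
    by (auto simp: F_def z_def less_ordinal.abs_eq ordIso_self_iff)
  have mono: "F x < F y" if "x < y" for x y
  proof -
    have of: "wo_rel.ofilter r (underS r a)" for a
      using r by (simp add: wo_rel_def wo_rel.underS_ofilter)
    have "{..<x} \<subset> {..<y}" using that by auto
    then have "underS r (g x) \<subset> underS r (g y)"
      unfolding underS_eq by (rule image_strict_mono[OF inj_on_subset[OF g subset_UNIV]])
    then have "Restr r (underS r (g x)) <o Restr r (underS r (g y))"
      using ofilter_subset_ordLess[OF r of of] by blast
    then show ?thesis
      using Well_order_Restr[OF r] by (simp add: F_def less_ordinal.abs_eq ordIso_self_iff)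
  qed
  have "x \<le> F x" for x
  proof (induction x rule: less_induct)
    case (less x)
    show ?case
    proof (rule ccontr)
      assume "\<not> x \<le> F x"
      then have "F x < x" by simp
      from less[OF this] mono[OF this] show False by simp
    qed
  qed
  with below[of z] show False by (meson leD)
qed

text \<open>
  Regularity of the successor cardinal: a union of few initial segments, each of them small, is
  too small to exhaust the ordinals. Every supremum in the definitions of sum and power of ordinals
  is taken over such a family, hence is a true supremum.
\<close>

lemma small_family_bounded:
  fixes f :: "'b \<Rightarrow> 'a ordinal"
  assumes "|I| \<le>o |UNIV :: 'a list set|"
  shows "\<exists>\<beta>. \<forall>i\<in>I. f i < \<beta>"
proof (rule ccontr)
  assume "\<not> ?thesis"
  then have "(\<Union>i\<in>I. {..<osuc (f i)}) = UNIV"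
    by (auto simp: not_less) (metis less_osuc order.strict_trans1)
  moreover have "|\<Union>i\<in>I. {..<osuc (f i)}| \<le>o |UNIV :: 'a list set|"
    using assms ordinal_below_small
    by (intro card_of_UNION_ordLeq_infinite) (auto simp: infinite_UNIV_listI)
  ultimately show False using ordinals_large by metis
qed

lemma less_osup_iff:
  assumes "\<forall>\<alpha>\<in>A. \<alpha> < \<delta>"
  shows "x < osup A \<longleftrightarrow> (\<exists>\<alpha>\<in>A. x < \<alpha>)"
proof -
  have "\<forall>\<alpha>\<in>A. \<alpha> \<le> \<delta>" using assms by (auto intro: less_imp_le)
  then have "\<forall>\<alpha>\<in>A. \<alpha> \<le> osup A"
    unfolding osup_def by (rule LeastI)
  moreover have "osup A \<le> x" if "\<forall>\<alpha>\<in>A. \<alpha> \<le> x"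
    unfolding osup_def using that by (rule Least_le)
  ultimately show ?thesis by (meson leD leI order.strict_trans2)
qed

lemma less_osup_below_iff: "x < osup (f ` {..<\<beta>}) \<longleftrightarrow> (\<exists>\<gamma><\<beta>. x < f \<gamma>)"
  for f :: "'a ordinal \<Rightarrow> 'a ordinal"
proof -
  obtain \<delta> where "\<forall>\<gamma>\<in>{..<\<beta>}. f \<gamma> < \<delta>"
    using small_family_bounded[OF ordinal_below_small] by blast
  then have "\<forall>\<alpha>\<in>f ` {..<\<beta>}. \<alpha> < \<delta>" by auto
  from less_osup_iff[OF this] show ?thesis by auto
qed

lemma less_osup_range_iff: "x < osup (range f) \<longleftrightarrow> (\<exists>n. x < f n)"
  for f :: "nat \<Rightarrow> 'a ordinal"
proof -
  have "|UNIV :: nat set| \<le>o |UNIV :: 'a list set|"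
    by (simp add: infinite_UNIV_listI flip: infinite_iff_card_of_nat)
  then obtain \<delta> where "\<forall>\<gamma>\<in>UNIV. f \<gamma> < \<delta>"
    using small_family_bounded by blast
  then have "\<forall>\<alpha>\<in>range f. \<alpha> < \<delta>" by auto
  from less_osup_iff[OF this] show ?thesis by auto
qed

unbundle no cardinal_syntax

lemma less_osuc_iff: "x < osuc y \<longleftrightarrow> x \<le> y"
  by (metis less_osuc not_le order.strict_trans1 osuc_le_iff)

lemma less_zero [simp]: "\<not> x < (0 :: 'a ordinal)"
  by (simp add: not_less)

lemma ordinal_pos_iff: "0 < (x :: 'a ordinal) \<longleftrightarrow> x \<noteq> 0"
  by (auto simp: less_le)

lemma ordinal_eqI:
  fixes a b :: "'a ordinal"
  assumes "\<And>x. x < a \<longleftrightarrow> x < b"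
  shows "a = b"
  using assms[of a] assms[of b] by simp

text \<open>
  The zero, successor and limit clauses of ordinal addition in one formula. Used as the
  characterisation of the ordinals below a sum, it makes case distinctions in the other laws of
  addition unnecessary.
\<close>

lemma less_oadd_iff: "x < oadd \<alpha> \<beta> \<longleftrightarrow> x < \<alpha> \<or> (\<exists>\<gamma><\<beta>. x \<le> oadd \<alpha> \<gamma>)"
proof (induction \<beta> arbitrary: x rule: less_induct)
  case (less \<beta>)
  show ?case
  proof (cases \<beta> rule: ordinal_cases)
    case (2 \<beta>')
    have "x < oadd \<alpha> \<beta> \<longleftrightarrow> x \<le> oadd \<alpha> \<beta>'" by (simp add: 2 less_osuc_iff)
    also have "\<dots> \<longleftrightarrow> x < \<alpha> \<or> (\<exists>\<gamma><\<beta>'. x \<le> oadd \<alpha> \<gamma>) \<or> x \<le> oadd \<alpha> \<beta>'"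
      using less[of \<beta>' x] by (auto simp: 2)
    also have "\<dots> \<longleftrightarrow> x < \<alpha> \<or> (\<exists>\<gamma><\<beta>. x \<le> oadd \<alpha> \<gamma>)"
      by (auto simp: 2 less_osuc_iff le_less)
    finally show ?thesis .
  next
    case 3
    have *: "x < oadd \<alpha> \<beta> \<longleftrightarrow> (\<exists>\<gamma><\<beta>. x < oadd \<alpha> \<gamma>)"
      by (simp add: 3 less_osup_below_iff)
    show ?thesis
    proof
      assume "x < \<alpha> \<or> (\<exists>\<gamma><\<beta>. x \<le> oadd \<alpha> \<gamma>)"
      then show "x < oadd \<alpha> \<beta>"
      proof
        assume "x < \<alpha>"
        then have "x < oadd \<alpha> 0" by simp
        then show ?thesis using 3 unfolding * is_limit_def by (metis ordinal_pos_iff)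
      next
        assume "\<exists>\<gamma><\<beta>. x \<le> oadd \<alpha> \<gamma>"
        then obtain \<gamma> where "\<gamma> < \<beta>" "x \<le> oadd \<alpha> \<gamma>" by blast
        then have "osuc \<gamma> < \<beta>" "x < oadd \<alpha> (osuc \<gamma>)"
          using 3 osuc_less_limit by (auto simp: less_osuc_iff)
        then show ?thesis unfolding * by blast
      qed
    qed (auto simp: * intro: less_imp_le)
  qed simp
qed

lemma oadd_strict_mono: "\<gamma> < \<beta> \<Longrightarrow> oadd \<alpha> \<gamma> < oadd \<alpha> \<beta>"
  unfolding less_oadd_iff by blast

lemma oadd_less_iff [simp]: "oadd \<alpha> \<gamma> < oadd \<alpha> \<beta> \<longleftrightarrow> \<gamma> < \<beta>"
  by (rule strict_mono_less[OF strict_monoI]) (rule oadd_strict_mono)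

lemma oadd_le_iff [simp]: "oadd \<alpha> \<gamma> \<le> oadd \<alpha> \<beta> \<longleftrightarrow> \<gamma> \<le> \<beta>"
  by (simp flip: not_less)

lemma le_oadd1 [simp]: "\<alpha> \<le> oadd \<alpha> \<beta>"
  by (metis oadd.simps(1) oadd_le_iff zero_le_ordinal)

lemma oadd_mono_left: "\<alpha> \<le> \<alpha>' \<Longrightarrow> oadd \<alpha> \<beta> \<le> oadd \<alpha>' \<beta>"
proof (induction \<beta> rule: less_induct)
  case (less \<beta>)
  show ?case
  proof (rule leI, rule notI)
    assume "oadd \<alpha>' \<beta> < oadd \<alpha> \<beta>"
    then consider "oadd \<alpha>' \<beta> < \<alpha>" | \<gamma> where "\<gamma> < \<beta>" "oadd \<alpha>' \<beta> \<le> oadd \<alpha> \<gamma>"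
      unfolding less_oadd_iff[of _ \<alpha>] by blast
    then show False
    proof cases
      case 1
      then show False using less.prems le_oadd1[of \<alpha>' \<beta>] by order
    next
      case 2
      then show False
        using less.IH[OF 2(1) less.prems] oadd_strict_mono[OF 2(1), of \<alpha>'] by order
    qed
  qed
qed

lemma oadd_zero_left [simp]: "oadd 0 \<beta> = \<beta>"
proof (induction \<beta> rule: less_induct)
  case (less \<beta>)
  have "x < oadd 0 \<beta> \<longleftrightarrow> (\<exists>\<gamma><\<beta>. x \<le> \<gamma>)" for x
    unfolding less_oadd_iff[of x] by (simp add: less cong: conj_cong)
  then have "x < oadd 0 \<beta> \<longleftrightarrow> x < \<beta>" for x
    by (auto intro: order.strict_trans1)
  then show ?case by (rule ordinal_eqI)
qed

lemma le_oadd2 [simp]: "\<beta> \<le> oadd \<alpha> \<beta>"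
  using oadd_mono_left[of 0 \<alpha> \<beta>] by simp

lemma oadd_assoc: "oadd (oadd \<alpha> \<beta>) \<gamma> = oadd \<alpha> (oadd \<beta> \<gamma>)"
proof (induction \<gamma> rule: less_induct)
  case (less \<gamma>)
  have "x < oadd (oadd \<alpha> \<beta>) \<gamma> \<longleftrightarrow> x < oadd \<alpha> (oadd \<beta> \<gamma>)" for x
  proof -
    have "x < oadd (oadd \<alpha> \<beta>) \<gamma> \<longleftrightarrow>
        x < oadd \<alpha> \<beta> \<or> (\<exists>\<delta><\<gamma>. x \<le> oadd \<alpha> (oadd \<beta> \<delta>))"
      using less by (auto simp: less_oadd_iff[of x "oadd \<alpha> \<beta>"])
    also have "\<dots> \<longleftrightarrow> x < \<alpha> \<or> (\<exists>y<\<beta>. x \<le> oadd \<alpha> y) \<or>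
        (\<exists>\<delta><\<gamma>. x \<le> oadd \<alpha> (oadd \<beta> \<delta>))"
      by (simp add: less_oadd_iff[of x \<alpha>] disj_assoc)
    also have "\<dots> \<longleftrightarrow> x < \<alpha> \<or> (\<exists>y<oadd \<beta> \<gamma>. x \<le> oadd \<alpha> y)"
      unfolding less_oadd_iff[of _ \<beta> \<gamma>] by (meson oadd_le_iff order.trans order.refl)
    also have "\<dots> \<longleftrightarrow> x < oadd \<alpha> (oadd \<beta> \<gamma>)"
      by (simp add: less_oadd_iff[of x \<alpha> "oadd \<beta> \<gamma>"])
    finally show ?thesis .
  qed
  then show ?case by (rule ordinal_eqI)
qed

lemma le_imp_oadd:
  assumes "\<alpha> \<le> \<gamma>"
  obtains \<delta> where "\<gamma> = oadd \<alpha> \<delta>"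
proof -
  define \<delta> where "\<delta> = (LEAST \<delta>. \<gamma> \<le> oadd \<alpha> \<delta>)"
  have 1: "\<gamma> \<le> oadd \<alpha> \<delta>" unfolding \<delta>_def by (rule LeastI[of "\<lambda>\<delta>. \<gamma> \<le> oadd \<alpha> \<delta>" \<gamma>]) (rule le_oadd2)
  have "\<not> \<gamma> < oadd \<alpha> \<delta>"
  proof
    assume "\<gamma> < oadd \<alpha> \<delta>"
    then obtain \<epsilon> where "\<epsilon> < \<delta>" "\<gamma> \<le> oadd \<alpha> \<epsilon>"
      using assms leD unfolding less_oadd_iff by blast
    then show False
      unfolding \<delta>_def using not_less_Least[of \<epsilon> "\<lambda>\<delta>. \<gamma> \<le> oadd \<alpha> \<delta>"] by simp
  qed
  with 1 have "\<gamma> = oadd \<alpha> \<delta>" by simp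
  then show thesis by (rule that)
qed

section \<open>Cantor normal form and the natural sum\<close>

lemma omega_pow_pos: "0 < omega_pow \<alpha>"
proof (induction \<alpha> rule: less_induct)
  case (less \<alpha>)
  show ?case
  proof (cases \<alpha> rule: ordinal_cases)
    case (2 \<beta>)
    then have "0 < omult_nat (omega_pow \<beta>) (Suc 0)" using less[of \<beta>] by simp
    then show ?thesis unfolding 2 omega_pow.simps(2) less_osup_range_iff by blast
  next
    case 3
    then have "0 < \<alpha>" by (simp add: is_limit_def ordinal_pos_iff)
    with less 3 show ?thesis by (auto simp: less_osup_below_iff)
  qed simp
qed

lemma less_omega_pow_osuc_iff: "x < omega_pow (osuc \<beta>) \<longleftrightarrow> (\<exists>n. x < omult_nat (omega_pow \<beta>) n)"
  by (simp add: less_osup_range_iff)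

lemma less_omega_pow_limit_iff:
  "is_limit \<alpha> \<Longrightarrow> x < omega_pow \<alpha> \<longleftrightarrow> (\<exists>\<beta><\<alpha>. x < omega_pow \<beta>)"
  by (simp add: less_osup_below_iff)

lemma omega_pow_less_osuc: "omega_pow \<beta> < omega_pow (osuc \<beta>)"
proof -
  have "oadd (omega_pow \<beta>) 0 < oadd (omega_pow \<beta>) (omega_pow \<beta>)"
    using omega_pow_pos by (simp only: oadd_less_iff)
  then have "omega_pow \<beta> < omult_nat (omega_pow \<beta>) (Suc (Suc 0))" by simp
  then show ?thesis unfolding less_omega_pow_osuc_iff by blast
qed

lemma omega_pow_strict_mono: "\<beta> < \<gamma> \<Longrightarrow> omega_pow \<beta> < omega_pow \<gamma>"
proof (induction \<gamma> rule: less_induct)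
  case (less \<gamma>)
  show ?case
  proof (cases \<gamma> rule: ordinal_cases)
    case (2 \<delta>)
    with less have "omega_pow \<beta> \<le> omega_pow \<delta>"
      by (auto simp: less_osuc_iff le_less)
    with omega_pow_less_osuc[of \<delta>] show ?thesis unfolding 2 by order
  next
    case 3
    with less have "osuc \<beta> < \<gamma>" by (simp add: osuc_less_limit)
    with omega_pow_less_osuc[of \<beta>] show ?thesis
      unfolding less_omega_pow_limit_iff[OF 3] by blast
  qed (use less in simp)
qed

lemma omega_pow_less_iff [simp]: "omega_pow \<beta> < omega_pow \<gamma> \<longleftrightarrow> \<beta> < \<gamma>"
  by (rule strict_mono_less[OF strict_monoI]) (rule omega_pow_strict_mono)

lemma omega_pow_le_iff [simp]: "omega_pow \<beta> \<le> omega_pow \<gamma> \<longleftrightarrow> \<beta> \<le> \<gamma>"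
  by (rule strict_mono_less_eq[OF strict_monoI]) (rule omega_pow_strict_mono)

lemma le_omega_pow: "\<beta> \<le> omega_pow \<beta>"
proof (induction \<beta> rule: less_induct)
  case (less \<beta>)
  show ?case
  proof (rule ccontr)
    assume "\<not> \<beta> \<le> omega_pow \<beta>"
    then have *: "omega_pow \<beta> < \<beta>" by simp
    from less[OF *] omega_pow_strict_mono[OF *] show False by simp
  qed
qed

lemma omult_nat_add: "omult_nat \<alpha> (m + n) = oadd (omult_nat \<alpha> m) (omult_nat \<alpha> n)"
  by (induction n) (simp_all add: oadd_assoc)

lemma omult_nat_Suc_left: "omult_nat \<alpha> (Suc n) = oadd \<alpha> (omult_nat \<alpha> n)"
  using omult_nat_add[of \<alpha> "Suc 0" n] by simp

text \<open>
  Powers of \<open>\<omega>\<close> are additively indecomposable: at a successor exponent the summands lie below finite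
  multiples of the preceding power, and these multiples add up to another one; at a limit exponent
  both summands already lie below some smaller power.
\<close>

lemma oadd_less_omega_pow:
  "x < omega_pow \<alpha> \<Longrightarrow> y < omega_pow \<alpha> \<Longrightarrow> oadd x y < omega_pow \<alpha>"
proof (induction \<alpha> rule: less_induct)
  case (less \<alpha>)
  show ?case
  proof (cases \<alpha> rule: ordinal_cases)
    case 1
    with less have "x \<le> 0" "y \<le> 0" by (simp_all add: less_osuc_iff)
    then have "x = 0" "y = 0" by (simp_all add: order.antisym)
    with less show ?thesis by simp
  next
    case (2 \<beta>)
    from less.prems obtain m n
      where mn: "x < omult_nat (omega_pow \<beta>) m" "y < omult_nat (omega_pow \<beta>) n"
      unfolding 2 less_omega_pow_osuc_iff by blast
    have "oadd x y \<le> oadd (omult_nat (omega_pow \<beta>) m) y"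
      using mn by (intro oadd_mono_left) simp
    also have "\<dots> < omult_nat (omega_pow \<beta>) (m + n)"
      using mn by (simp add: omult_nat_add)
    finally show ?thesis unfolding 2 less_omega_pow_osuc_iff by blast
  next
    case 3
    with less obtain \<beta> \<gamma> where b: "\<beta> < \<alpha>" "\<gamma> < \<alpha>" "x < omega_pow \<beta>" "y < omega_pow \<gamma>"
      unfolding less_omega_pow_limit_iff[OF 3] by blast
    define \<delta> where "\<delta> = max \<beta> \<gamma>"
    have "\<delta> < \<alpha>" "omega_pow \<beta> \<le> omega_pow \<delta>" "omega_pow \<gamma> \<le> omega_pow \<delta>"
      using b by (simp_all add: \<delta>_def)
    with b less.IH[of \<delta>] show ?thesis
      unfolding less_omega_pow_limit_iff[OF 3] by (meson order.strict_trans2)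
  qed
qed

text \<open>
  A Cantor normal form with the coefficients written out as repetitions of exponents. A
  nonincreasing list of exponents carries the same information as a finite multiset.
\<close>

primrec omega_sum :: "'a ordinal list \<Rightarrow> 'a ordinal" where
  "omega_sum [] = 0"
| "omega_sum (\<alpha> # as) = oadd (omega_pow \<alpha>) (omega_sum as)"

lemma omega_sum_append: "omega_sum (as @ bs) = oadd (omega_sum as) (omega_sum bs)"
  by (induction as) (simp_all add: oadd_assoc)

lemma omega_sum_replicate: "omega_sum (replicate n \<alpha>) = omult_nat (omega_pow \<alpha>) n"
  by (induction n) (simp_all add: omult_nat_Suc_left del: omult_nat.simps(2))

lemma omega_sum_less: "\<forall>\<alpha>\<in>set as. \<alpha> < \<beta> \<Longrightarrow> omega_sum as < omega_pow \<beta>"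
  by (induction as) (simp_all add: omega_pow_pos oadd_less_omega_pow)

text \<open>
  On nonincreasing lists the multiset order is the lexicographic order. A larger first exponent
  decides the comparison because its power alone exceeds every sum of smaller powers; equal first
  exponents cancel.
\<close>

lemma omega_sum_strict_mono:
  assumes "sorted_wrt (\<ge>) as" "sorted_wrt (\<ge>) bs" "mset as < mset bs"
  shows "omega_sum as < omega_sum bs"
  using assms
proof (induction as arbitrary: bs)
  case Nil
  then obtain b bs' where bs: "bs = b # bs'" by (cases bs) auto
  have "0 < omega_pow b" by (rule omega_pow_pos)
  also have "\<dots> \<le> omega_sum bs" by (simp add: bs)
  finally show ?case by simp
next
  case (Cons a as)
  then obtain b bs' where bs: "bs = b # bs'" by (cases bs) auto
  consider "a < b" | "a = b" | "b < a" by fastforce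
  then show ?case
  proof cases
    case 1
    with Cons.prems have "omega_sum (a # as) < omega_pow b"
      by (intro omega_sum_less) auto
    also have "\<dots> \<le> omega_sum bs" by (simp add: bs)
    finally show ?thesis .
  next
    case 2
    with Cons show ?thesis by (simp add: bs)
  next
    case 3
    with Cons.prems have "mset bs < mset (a # as)"
      by (intro ex_gt_imp_less_multiset exI[of _ a]) (auto simp: bs)
    with Cons.prems show ?thesis by (meson order.asym)
  qed
qed

text \<open>
  Existence of the Cantor normal form: split off the largest power \<open>\<omega>\<^sup>\<alpha> \<le> \<xi>\<close> on the left. The
  remainder is strictly smaller than \<open>\<xi>\<close>, since an ordinal that absorbs \<open>\<omega>\<^sup>\<alpha>\<close> on the left is at
  least every finite multiple of it, that is, at least the next power.
\<close>

lemma ordinal_eq_omega_sum: "\<exists>as. sorted_wrt (\<ge>) as \<and> omega_sum as = \<xi>"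
proof (induction \<xi> rule: less_induct)
  case (less \<xi>)
  show ?case
  proof (cases "\<xi> = 0")
    case True
    then show ?thesis by (intro exI[of _ "[]"]) simp
  next
    case False
    \<comment> \<open>By continuity of the powers, the least exponent whose power exceeds \<open>\<xi>\<close> is a successor.\<close>
    define \<gamma> where "\<gamma> = (LEAST \<gamma>. \<xi> < omega_pow \<gamma>)"
    have "\<xi> < omega_pow (osuc \<xi>)"
      using less_osuc le_omega_pow by (rule order.strict_trans2)
    then have \<gamma>: "\<xi> < omega_pow \<gamma>"
      unfolding \<gamma>_def by (rule LeastI[of "\<lambda>\<gamma>. \<xi> < omega_pow \<gamma>"])
    have least: "omega_pow \<delta> \<le> \<xi>" if "\<delta> < \<gamma>" for \<delta>
      using not_less_Least[of \<delta> "\<lambda>\<gamma>. \<xi> < omega_pow \<gamma>"] that by (simp add: \<gamma>_def)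
    obtain \<alpha> where \<alpha>: "\<gamma> = osuc \<alpha>"
    proof (cases \<gamma> rule: ordinal_cases)
      case 1
      with \<gamma> False have False by (simp add: less_osuc_iff order.antisym)
      then show thesis ..
    next
      case 3
      with \<gamma> obtain \<delta> where "\<delta> < \<gamma>" "\<xi> < omega_pow \<delta>"
        unfolding less_omega_pow_limit_iff[OF 3] by blast
      with least[of \<delta>] have False by simp
      then show thesis ..
    qed
    have "omega_pow \<alpha> \<le> \<xi>" by (rule least) (simp add: \<alpha>)
    then obtain \<xi>' where \<xi>': "\<xi> = oadd (omega_pow \<alpha>) \<xi>'" by (rule le_imp_oadd)
    have "\<xi>' \<noteq> \<xi>"
    proof
      assume "\<xi>' = \<xi>"
      have "omult_nat (omega_pow \<alpha>) n \<le> \<xi>" for n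
      proof (induction n)
        case (Suc n)
        then have "oadd (omega_pow \<alpha>) (omult_nat (omega_pow \<alpha>) n) \<le> oadd (omega_pow \<alpha>) \<xi>"
          by (simp only: oadd_le_iff)
        also have "\<dots> = \<xi>" using \<xi>' \<open>\<xi>' = \<xi>\<close> by simp
        finally show ?case by (simp only: omult_nat_Suc_left)
      qed simp
      moreover obtain n where "\<xi> < omult_nat (omega_pow \<alpha>) n"
        using \<gamma> unfolding \<alpha> less_omega_pow_osuc_iff by blast
      ultimately show False by (meson leD)
    qed
    moreover have "\<xi>' \<le> \<xi>" unfolding \<xi>' by (rule le_oadd2)
    ultimately have "\<xi>' < \<xi>" by simp
    with less obtain as where as: "sorted_wrt (\<ge>) as" "omega_sum as = \<xi>'" by blast
    have "\<beta> \<le> \<alpha>" if "\<beta> \<in> set as" for \<beta>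
    proof -
      obtain b as' where b: "as = b # as'" using \<open>\<beta> \<in> set as\<close> by (cases as) auto
      have "omega_pow b \<le> \<xi>'" using as(2) by (auto simp: b)
      also have "\<dots> < omega_pow (osuc \<alpha>)"
        using \<open>\<xi>' < \<xi>\<close> \<gamma> unfolding \<alpha> by (rule order.strict_trans)
      finally have "b \<le> \<alpha>" by (simp only: omega_pow_less_iff less_osuc_iff)
      with that as(1) show ?thesis by (auto simp: b)
    qed
    with as show ?thesis by (intro exI[of _ "\<alpha> # as"]) (simp add: \<xi>')
  qed
qed

definition cnf :: "'a ordinal multiset \<Rightarrow> 'a ordinal" where
  "cnf M = omega_sum (rev (sorted_list_of_multiset M))"

lemma rev_sorted_list_of_multiset_mset:
  "sorted_wrt (\<ge>) as \<Longrightarrow> rev (sorted_list_of_multiset (mset as)) = as"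
  for as :: "'b :: linorder list"
  by (metis mset_rev rev_rev_ident sorted_list_of_multiset_mset sorted_sort_id sorted_wrt_rev)

lemma cnf_mset: "sorted_wrt (\<ge>) as \<Longrightarrow> cnf (mset as) = omega_sum as"
  by (simp add: cnf_def rev_sorted_list_of_multiset_mset del: sorted_list_of_multiset_mset)

lemma cnf_strict_mono: "M < N \<Longrightarrow> cnf M < cnf N"
  unfolding cnf_def
  by (rule omega_sum_strict_mono) (simp_all add: sorted_wrt_rev)

lemma cnf_less_iff [simp]: "cnf M < cnf N \<longleftrightarrow> M < N"
  by (rule strict_mono_less[OF strict_monoI]) (rule cnf_strict_mono)

lemma cnf_le_iff [simp]: "cnf M \<le> cnf N \<longleftrightarrow> M \<le> N"
  by (rule strict_mono_less_eq[OF strict_monoI]) (rule cnf_strict_mono)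

lemma cnf_eq_iff: "cnf M = cnf N \<longleftrightarrow> M = N"
  by (rule strict_mono_eq[OF strict_monoI]) (rule cnf_strict_mono)

lemma cnf_empty: "cnf {#} = 0"
  by (simp add: cnf_def)

lemma cnf_cases:
  obtains M where "\<xi> = cnf M"
  using ordinal_eq_omega_sum cnf_mset by metis

lemma cantor_sum_eq_cnf:
  assumes "sorted_wrt (>) as"
  shows "cantor_sum as m = cnf (\<Sum>\<alpha>\<in>set as. replicate_mset (m \<alpha>) \<alpha>)"
proof -
  let ?l = "\<lambda>as. concat (map (\<lambda>\<alpha>. replicate (m \<alpha>) \<alpha>) as)"
  have "cantor_sum as m = omega_sum (?l as)"
    by (induction as) (simp_all add: omega_sum_append omega_sum_replicate)
  moreover have "sorted_wrt (\<ge>) (replicate n \<alpha>)" for n and \<alpha> :: "'a ordinal"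
    by (induction n) auto
  then have "sorted_wrt (\<ge>) (?l as)" using assms
    by (induction as) (auto simp: sorted_wrt_append less_imp_le)
  moreover have "mset (?l as) = (\<Sum>\<alpha>\<in>set as. replicate_mset (m \<alpha>) \<alpha>)" using assms
    by (induction as) (auto simp: sum.insert_if)
  ultimately show ?thesis using cnf_mset by metis
qed

text \<open>
  Two ordinals can be written over common exponents, namely those that occur in either of them.
  Injectivity of the normal form makes the description unique, so the definite description in the
  definition of the natural sum denotes the value.
\<close>

lemma natural_sum_cnf: "cnf M \<oplus> cnf N = cnf (M + N)"
  unfolding natural_sum_def
proof (rule the_equality)
  let ?as = "rev (sorted_list_of_set (set_mset M \<union> set_mset N))"
  have sorted: "sorted_wrt (>) ?as"
    by (simp add: sorted_wrt_rev)
  have eq: "(\<Sum>\<alpha>\<in>set ?as. replicate_mset (count K \<alpha>) \<alpha>) = K"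
    if "set_mset K \<subseteq> set_mset M \<union> set_mset N" for K
    using that by (intro multiset_eqI) (auto simp: count_sum count_eq_zero_iff)
  show "\<exists>as m n. sorted_wrt (>) as \<and> cnf M = cantor_sum as m \<and> cnf N = cantor_sum as n
      \<and> cnf (M + N) = cantor_sum as (\<lambda>\<alpha>. m \<alpha> + n \<alpha>)"
    using sorted eq[of M] eq[of N] eq[of "M + N"]
    by (intro exI[of _ ?as] exI[of _ "count M"] exI[of _ "count N"])
      (simp add: cantor_sum_eq_cnf del: set_rev)
next
  fix \<eta>
  assume "\<exists>as m n. sorted_wrt (>) as \<and> cnf M = cantor_sum as m \<and> cnf N = cantor_sum as n
      \<and> \<eta> = cantor_sum as (\<lambda>\<alpha>. m \<alpha> + n \<alpha>)"
  then obtain as m n where *: "sorted_wrt (>) as" "cnf M = cantor_sum as m"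
    "cnf N = cantor_sum as n" "\<eta> = cantor_sum as (\<lambda>\<alpha>. m \<alpha> + n \<alpha>)" by blast
  have "(\<Sum>\<alpha>\<in>set as. replicate_mset (m \<alpha> + n \<alpha>) \<alpha>) =
      (\<Sum>\<alpha>\<in>set as. replicate_mset (m \<alpha>) \<alpha>) + (\<Sum>\<alpha>\<in>set as. replicate_mset (n \<alpha>) \<alpha>)"
    by (rule multiset_eqI) (simp add: count_sum sum.distrib)
  with * show "\<eta> = cnf (M + N)"
    by (simp add: cantor_sum_eq_cnf cnf_eq_iff)
qed

lemma natural_sum_commute: "\<xi> \<oplus> \<zeta> = \<zeta> \<oplus> \<xi>"
  by (metis cnf_cases natural_sum_cnf add.commute)

lemma natural_sum_zero [simp]: "\<xi> \<oplus> 0 = \<xi>"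
  by (metis cnf_cases cnf_empty natural_sum_cnf add_0_right)

lemma natural_sum_less_left: "\<xi> < \<xi>' \<Longrightarrow> \<xi> \<oplus> \<zeta> < \<xi>' \<oplus> \<zeta>"
  by (cases \<xi> rule: cnf_cases; cases \<xi>' rule: cnf_cases; cases \<zeta> rule: cnf_cases)
    (simp add: natural_sum_cnf)

lemma natural_sum_less_right: "\<zeta> < \<zeta>' \<Longrightarrow> \<xi> \<oplus> \<zeta> < \<xi> \<oplus> \<zeta>'"
  using natural_sum_less_left[of \<zeta> \<zeta>' \<xi>] by (simp add: natural_sum_commute[of \<xi>])

lemma natural_sum_mono:
  assumes "\<xi> \<le> \<xi>'" "\<zeta> \<le> \<zeta>'"
  shows "\<xi> \<oplus> \<zeta> \<le> \<xi>' \<oplus> \<zeta>'"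
  using assms
  by (cases \<xi> rule: cnf_cases; cases \<xi>' rule: cnf_cases;
      cases \<zeta> rule: cnf_cases; cases \<zeta>' rule: cnf_cases)
    (simp add: natural_sum_cnf add_mono)

text \<open>
  The multiset version of the fact that \<open>\<xi> \<oplus> \<zeta>\<close> is the least ordinal above all \<open>\<xi>' \<oplus> \<zeta>\<close> with
  \<open>\<xi>' < \<xi>\<close> and all \<open>\<xi> \<oplus> \<zeta>'\<close> with \<open>\<zeta>' < \<zeta>\<close>. Let \<open>\<alpha>\<close> be the largest element at which \<open>X\<close> and the
  union differ. One of the summands contains \<open>\<alpha>\<close>; replacing one copy of \<open>\<alpha>\<close> there by all elements
  of \<open>X\<close> below \<open>\<alpha>\<close> makes it smaller, while the union still contains \<open>X\<close>.
\<close>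

lemma multiset_le_union_cases:
  fixes X A B :: "'b :: linorder multiset"
  assumes "X < A + B"
  shows "(\<exists>A'<A. X \<le> A' + B) \<or> (\<exists>B'<B. X \<le> A + B')"
proof -
  define D where "D = {\<alpha> \<in> set_mset (X + A + B). count X \<alpha> \<noteq> count (A + B) \<alpha>}"
  define \<alpha> where "\<alpha> = Max D"
  have fin: "finite D" by (simp add: D_def)
  have outside: "count X \<beta> = count (A + B) \<beta>" if "\<beta> \<notin> D" for \<beta>
    using that by (auto simp: D_def not_in_iff)
  have "D \<noteq> {}"
  proof
    assume "D = {}"
    then have "X = A + B" using outside by (intro multiset_eqI) simp
    with assms show False by simp
  qed
  then have "\<alpha> \<in> D" using fin by (simp add: \<alpha>_def)
  have above: "count X \<beta> = count A \<beta> + count B \<beta>" if "\<alpha> < \<beta>" for \<beta>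
  proof -
    have "\<beta> \<notin> D" using Max_ge[OF fin, of \<beta>] that by (auto simp: \<alpha>_def leD)
    then show ?thesis using outside[of \<beta>] by simp
  qed
  have "count X \<alpha> < count A \<alpha> + count B \<alpha>"
  proof (rule ccontr)
    assume "\<not> ?thesis"
    with \<open>\<alpha> \<in> D\<close> have "count (A + B) \<alpha> < count X \<alpha>" by (auto simp: D_def)
    with assms obtain \<beta> where "\<alpha> < \<beta>" "count X \<beta> < count (A + B) \<beta>"
      unfolding less_multiset\<^sub>H\<^sub>O by blast
    with above show False by simp
  qed
  define L where "L = filter_mset (\<lambda>\<beta>. \<beta> < \<alpha>) X"
  have shrink: "\<exists>U'<U. X \<le> U' + V"
    if "U + V = A + B" "\<alpha> \<in># U" for U V
  proof (intro exI conjI)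
    have UV: "count U \<beta> + count V \<beta> = count A \<beta> + count B \<beta>" for \<beta>
      using that(1) by (metis count_union)
    have "U - {#\<alpha>#} + L < U - {#\<alpha>#} + {#\<alpha>#}"
      unfolding add_less_cancel_left by (simp add: L_def)
    then show "U - {#\<alpha>#} + L < U" using that(2) by simp
    have "X \<subseteq># U - {#\<alpha>#} + L + V"
    proof (rule mset_subset_eqI)
      fix \<beta>
      consider "\<beta> < \<alpha>" | "\<beta> = \<alpha>" | "\<alpha> < \<beta>" by fastforce
      then show "count X \<beta> \<le> count (U - {#\<alpha>#} + L + V) \<beta>"
      proof cases
        case 1 then show ?thesis by (simp add: L_def)
      next
        case 2
        then show ?thesis
          using UV[of \<alpha>] \<open>count X \<alpha> < _\<close> by simp
      next
        case 3
        then have "\<beta> \<noteq> \<alpha>" by simp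
        then show ?thesis using above[OF 3] UV[of \<beta>] by simp
      qed
    qed
    then show "X \<le> U - {#\<alpha>#} + L + V" by (rule subset_eq_imp_le_multiset)
  qed
  have "\<alpha> \<in># A \<or> \<alpha> \<in># B"
    using \<open>count X \<alpha> < _\<close> by (metis add_0 count_inI not_less_zero)
  then show ?thesis
    using shrink[of A B] shrink[of B A] by (auto simp: add.commute)
qed

lemma le_natural_sum_cases:
  assumes "\<eta> < \<xi> \<oplus> \<zeta>"
  shows "(\<exists>\<xi>'<\<xi>. \<eta> \<le> \<xi>' \<oplus> \<zeta>) \<or> (\<exists>\<zeta>'<\<zeta>. \<eta> \<le> \<xi> \<oplus> \<zeta>')"
proof -
  obtain X A B where XAB: "\<eta> = cnf X" "\<xi> = cnf A" "\<zeta> = cnf B" by (metis cnf_cases)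
  with assms have "X < A + B" by (simp add: natural_sum_cnf)
  from multiset_le_union_cases[OF this] show ?thesis
    unfolding XAB by (metis cnf_less_iff cnf_le_iff natural_sum_cnf)
qed

text \<open>
  Decrease first \<open>\<xi>\<close> and then \<open>\<zeta>\<close> as far as the sum stays at least \<open>\<eta>\<close>. If the resulting sum
  exceeded \<open>\<eta>\<close>, one of the two could be decreased further.
\<close>

lemma natural_sum_exact:
  assumes "\<eta> \<le> \<xi> \<oplus> \<zeta>"
  obtains \<xi>' \<zeta>' where "\<xi>' \<le> \<xi>" "\<zeta>' \<le> \<zeta>" "\<xi>' \<oplus> \<zeta>' = \<eta>"
proof -
  define \<xi>' where "\<xi>' = (LEAST x. \<eta> \<le> x \<oplus> \<zeta>)"
  have x: "\<eta> \<le> \<xi>' \<oplus> \<zeta>" unfolding \<xi>'_def by (rule LeastI) (rule assms)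
  have xle: "\<xi>' \<le> \<xi>" unfolding \<xi>'_def by (rule Least_le) (rule assms)
  have xmin: "\<not> \<eta> \<le> x \<oplus> \<zeta>" if "x < \<xi>'" for x
    using that unfolding \<xi>'_def by (rule not_less_Least)
  define \<zeta>' where "\<zeta>' = (LEAST z. \<eta> \<le> \<xi>' \<oplus> z)"
  have z: "\<eta> \<le> \<xi>' \<oplus> \<zeta>'" unfolding \<zeta>'_def by (rule LeastI) (rule x)
  have zle: "\<zeta>' \<le> \<zeta>" unfolding \<zeta>'_def by (rule Least_le) (rule x)
  have zmin: "\<not> \<eta> \<le> \<xi>' \<oplus> z" if "z < \<zeta>'" for z
    using that unfolding \<zeta>'_def by (rule not_less_Least)
  have "\<not> \<eta> < \<xi>' \<oplus> \<zeta>'"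
  proof
    assume "\<eta> < \<xi>' \<oplus> \<zeta>'"
    then consider x where "x < \<xi>'" "\<eta> \<le> x \<oplus> \<zeta>'" | z where "z < \<zeta>'" "\<eta> \<le> \<xi>' \<oplus> z"
      using le_natural_sum_cases by blast
    then show False
    proof cases
      case 1
      have "x \<oplus> \<zeta>' \<le> x \<oplus> \<zeta>" using zle by (simp add: natural_sum_mono)
      with 1 xmin show False by (meson order.trans)
    qed (use zmin in blast)
  qed
  with z have "\<xi>' \<oplus> \<zeta>' = \<eta>" by simp
  with xle zle show thesis by (rule that)
qed

section \<open>Rank relative to a set of leaves\<close>

text \<open>
  The condition that the node \<open>t\<close> has rank at least \<open>\<xi>\<close> relative to the leaves in \<open>A\<close>, where \<open>K u\<close>
  is the set of leaves admitted at \<open>u\<close>. Taking \<open>K\<close> to be a colour class gives the colour rank, and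
  taking it to be everything gives the ordinary rank. Working with ``rank at least \<open>\<xi>\<close>'' instead of a
  rank function avoids suprema. The node \<open>t\<close> may lie outside \<open>T\<close>, so that the empty sequence can
  serve as the root of a \<open>B\<close>-tree.
\<close>

function reach ::
  "'a list set \<Rightarrow> ('a list \<Rightarrow> 'a list set) \<Rightarrow> 'b ordinal \<Rightarrow> 'a list \<Rightarrow> 'a list set \<Rightarrow> bool" where
  "reach T K \<xi> t A \<longleftrightarrow> A \<inter> ends T t \<noteq> {} \<and>
     (\<forall>\<zeta><\<xi>. \<exists>u\<in>T. strict_prefix t u \<and> reach T K \<zeta> u (A \<inter> K u))"
  by pat_completeness auto
termination
  by (relation "inv_image {(x, y). x < y} (\<lambda>(T, K, \<xi>, t, A). \<xi>)") (auto intro: wf)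

declare reach.simps [simp del]

lemma reachI:
  assumes "A \<inter> ends T t \<noteq> {}"
    and "\<And>\<zeta>. \<zeta> < \<xi> \<Longrightarrow> \<exists>u\<in>T. strict_prefix t u \<and> reach T K \<zeta> u (A \<inter> K u)"
  shows "reach T K \<xi> t A"
  using assms by (subst reach.simps) blast

lemma reach_ends: "reach T K \<xi> t A \<Longrightarrow> A \<inter> ends T t \<noteq> {}"
  by (subst (asm) reach.simps) blast

lemma reachE:
  assumes "reach T K \<xi> t A" "\<zeta> < \<xi>"
  obtains u where "u \<in> T" "strict_prefix t u" "reach T K \<zeta> u (A \<inter> K u)"
  using assms by (subst (asm) reach.simps) blast

lemma reach_zero: "reach T K 0 t A \<longleftrightarrow> A \<inter> ends T t \<noteq> {}"
  by (subst reach.simps) simp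

lemma ends_antimono: "prefix s t \<Longrightarrow> ends T t \<subseteq> ends T s"
  by (auto simp: ends_def intro: prefix_order.trans)

lemma reach_mono:
  assumes "reach T K \<xi> t A" "\<zeta> \<le> \<xi>" "prefix s t" "A \<subseteq> B"
  shows "reach T K \<zeta> s B"
  using assms
proof (induction \<zeta> arbitrary: \<xi> s t A B rule: less_induct)
  case (less \<zeta>)
  show ?case
  proof (rule reachI)
    show "B \<inter> ends T s \<noteq> {}"
      using reach_ends[OF less.prems(1)] less.prems(4) ends_antimono[OF less.prems(3)] by blast
  next
    fix \<eta> assume "\<eta> < \<zeta>"
    then have "\<eta> < \<xi>" using less.prems(2) by (rule order.strict_trans2)
    with less.prems(1) obtain u where u: "u \<in> T" "strict_prefix t u" "reach T K \<eta> u (A \<inter> K u)"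
      by (rule reachE)
    have "reach T K \<eta> u (B \<inter> K u)"
      using less.prems(4) by (intro less.IH[OF \<open>\<eta> < \<zeta>\<close> u(3)]) auto
    moreover have "strict_prefix s u"
      using less.prems(3) u(2) by (rule prefix_order.le_less_trans)
    ultimately show "\<exists>u\<in>T. strict_prefix s u \<and> reach T K \<eta> u (B \<inter> K u)"
      using u(1) by blast
  qed
qed

lemma reach_osuc:
  assumes "u \<in> T" "strict_prefix t u" "reach T K \<zeta> u (A \<inter> K u)"
  shows "reach T K (osuc \<zeta>) t A"
proof (rule reachI)
  have "prefix t u" using assms(2) by simp
  then show "A \<inter> ends T t \<noteq> {}"
    using reach_ends[OF assms(3)] ends_antimono by blast
next
  fix \<eta> assume "\<eta> < osuc \<zeta>"
  then have "reach T K \<eta> u (A \<inter> K u)"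
    by (intro reach_mono[OF assms(3)]) (simp_all add: less_osuc_iff)
  with assms show "\<exists>u\<in>T. strict_prefix t u \<and> reach T K \<eta> u (A \<inter> K u)" by blast
qed

text \<open>
  The ranks attained form an initial segment of the ordinals that is closed under limits, because
  the condition at a limit refers only to smaller ordinals.
\<close>

lemma reach_greatest:
  fixes \<xi> :: "'b ordinal"
  assumes "A \<inter> ends T t \<noteq> {}" "\<not> reach T K \<xi> t A"
  obtains \<zeta> :: "'b ordinal" where "reach T K \<zeta> t A" "\<not> reach T K (osuc \<zeta>) t A"
proof -
  define \<gamma> :: "'b ordinal" where "\<gamma> = (LEAST \<gamma>. \<not> reach T K \<gamma> t A)"
  have \<gamma>: "\<not> reach T K \<gamma> t A"
    unfolding \<gamma>_def by (rule LeastI[of "\<lambda>\<gamma>. \<not> reach T K \<gamma> t A" \<xi>]) (rule assms)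
  have least: "reach T K \<zeta> t A" if "\<zeta> < \<gamma>" for \<zeta>
    using not_less_Least[OF that[unfolded \<gamma>_def]] by simp
  show thesis
  proof (cases \<gamma> rule: ordinal_cases)
    case 1
    with \<gamma> assms show thesis by (simp add: reach_zero)
  next
    case (2 \<zeta>)
    with \<gamma> least[of \<zeta>] that show thesis by simp
  next
    case 3
    have "reach T K \<gamma> t A"
    proof (rule reachI[OF assms(1)])
      fix \<zeta> assume "\<zeta> < \<gamma>"
      with 3 have "osuc \<zeta> < \<gamma>" by (rule osuc_less_limit)
      from reachE[OF least[OF this] less_osuc]
      show "\<exists>u\<in>T. strict_prefix t u \<and> reach T K \<zeta> u (A \<inter> K u)" by blast
    qed
    with \<gamma> show thesis ..
  qed
qed

text \<open>
  The rank relative to a union is the maximum of the two ranks. If both parts fail to have rank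
  \<open>\<xi>\<close>, they fail for some \<open>\<zeta>\<^sub>0, \<zeta>\<^sub>1 < \<xi>\<close> at all nodes above \<open>t\<close>; a node above \<open>t\<close> whose rank
  relative to the union is at least the larger of the two then contradicts the induction hypothesis.
\<close>

lemma reach_split:
  assumes "reach T (\<lambda>_. UNIV) \<xi> t A" "A \<inter> ends T t \<subseteq> A\<^sub>0 \<union> A\<^sub>1"
  shows "reach T (\<lambda>_. UNIV) \<xi> t A\<^sub>0 \<or> reach T (\<lambda>_. UNIV) \<xi> t A\<^sub>1"
  using assms
proof (induction \<xi> arbitrary: t rule: less_induct)
  case (less \<xi>)
  show ?case
  proof (cases "\<xi> = 0")
    case True
    with less.prems show ?thesis by (auto simp: reach_zero)
  next
    case False
    then have pos: "0 < \<xi>" by (simp add: ordinal_pos_iff)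
    \<comment> \<open>If no leaf of \<open>B\<close> is left above \<open>t\<close>, then the witness is \<open>\<zeta> = 0\<close>; it is below \<open>\<xi>\<close> as \<open>\<xi> \<noteq> 0\<close>.\<close>
    have stuck: "\<exists>\<zeta><\<xi>. \<forall>u\<in>T. strict_prefix t u \<longrightarrow> \<not> reach T (\<lambda>_. UNIV) \<zeta> u B"
      if "\<not> reach T (\<lambda>_. UNIV) \<xi> t B" for B
    proof (cases "B \<inter> ends T t = {}")
      case True
      have "\<not> reach T (\<lambda>_. UNIV) 0 u B" if "strict_prefix t u" for u
      proof -
        have "ends T u \<subseteq> ends T t" using that by (intro ends_antimono) simp
        with True show ?thesis by (auto simp: reach_zero)
      qed
      with pos show ?thesis by blast
    next
      case False
      with that show ?thesis by (subst (asm) reach.simps) auto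
    qed
    show ?thesis
    proof (rule ccontr)
      assume "\<not> ?thesis"
      then obtain \<zeta>\<^sub>0 \<zeta>\<^sub>1
        where z: "\<zeta>\<^sub>0 < \<xi>" "\<forall>u\<in>T. strict_prefix t u \<longrightarrow> \<not> reach T (\<lambda>_. UNIV) \<zeta>\<^sub>0 u A\<^sub>0"
          "\<zeta>\<^sub>1 < \<xi>" "\<forall>u\<in>T. strict_prefix t u \<longrightarrow> \<not> reach T (\<lambda>_. UNIV) \<zeta>\<^sub>1 u A\<^sub>1"
        using stuck by meson
      define \<zeta> where "\<zeta> = max \<zeta>\<^sub>0 \<zeta>\<^sub>1"
      have "\<zeta> < \<xi>" using z by (simp add: \<zeta>_def)
      with less.prems(1) obtain u
        where u: "u \<in> T" "strict_prefix t u" "reach T (\<lambda>_. UNIV) \<zeta> u A"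
        by (rule reachE) simp
      have "ends T u \<subseteq> ends T t" using u(2) by (intro ends_antimono) simp
      with less.prems(2) have "A \<inter> ends T u \<subseteq> A\<^sub>0 \<union> A\<^sub>1" by blast
      from less.IH[OF \<open>\<zeta> < \<xi>\<close> u(3) this]
      consider "reach T (\<lambda>_. UNIV) \<zeta> u A\<^sub>0" | "reach T (\<lambda>_. UNIV) \<zeta> u A\<^sub>1" by blast
      then show False
      proof cases
        case 1
        then have "reach T (\<lambda>_. UNIV) \<zeta>\<^sub>0 u A\<^sub>0" by (rule reach_mono) (simp_all add: \<zeta>_def)
        with u z show False by blast
      next
        case 2
        then have "reach T (\<lambda>_. UNIV) \<zeta>\<^sub>1 u A\<^sub>1" by (rule reach_mono) (simp_all add: \<zeta>_def)
        with u z show False by blast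
      qed
    qed
  qed
qed

text \<open>
  The heart of the proof. If some colour rank is at least \<open>\<eta>\<close>, the other summand may be zero.
  Otherwise let \<open>\<xi>\<close>, \<open>\<zeta>\<close> be the exact colour ranks of \<open>t\<close> and suppose \<open>\<xi> \<oplus> \<zeta> < \<eta>\<close>. Then some \<open>u\<close>
  above \<open>t\<close> has ordinary rank at least \<open>\<xi> \<oplus> \<zeta>\<close>, and it keeps this rank relative to the leaves of one
  colour at \<open>u\<close>. The induction hypothesis gives colour ranks of \<open>u\<close> with natural sum at least
  \<open>\<xi> \<oplus> \<zeta>\<close>. But one of them is strictly below the corresponding rank of \<open>t\<close>, since \<open>u\<close> can be added
  in front, and the other is not above.
\<close>

lemma reach_colors:
  fixes \<eta> :: "'b ordinal"
  assumes col: "coloring T C" and "reach T (\<lambda>_. UNIV) \<eta> t A"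
  shows "\<exists>\<xi> \<zeta>. reach T (C 0) \<xi> t A \<and> reach T (C 1) \<zeta> t A \<and> \<eta> \<le> \<xi> \<oplus> \<zeta>"
  using assms(2)
proof (induction \<eta> arbitrary: t A rule: less_induct)
  case (less \<eta>)
  have ne: "A \<inter> ends T t \<noteq> {}" using reach_ends[OF less.prems] .
  then have zero: "reach T (C j) (0 :: 'b ordinal) t A" for j by (simp add: reach_zero)
  consider "reach T (C 0) \<eta> t A" | "reach T (C 1) \<eta> t A"
    | "\<not> reach T (C 0) \<eta> t A" "\<not> reach T (C 1) \<eta> t A" by blast
  then show ?case
  proof cases
    case 1
    with zero show ?thesis by (intro exI[of _ \<eta>] exI[of _ 0]) simp
  next
    case 2
    with zero show ?thesis
      by (intro exI[of _ 0] exI[of _ \<eta>]) (simp add: natural_sum_commute[of 0])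
  next
    case 3
    obtain \<xi> :: "'b ordinal" where \<xi>: "reach T (C 0) \<xi> t A" "\<not> reach T (C 0) (osuc \<xi>) t A"
      using ne 3(1) by (rule reach_greatest)
    obtain \<zeta> :: "'b ordinal" where \<zeta>: "reach T (C 1) \<zeta> t A" "\<not> reach T (C 1) (osuc \<zeta>) t A"
      using ne 3(2) by (rule reach_greatest)
    have bound0: "\<alpha> \<le> \<xi>" if "reach T (C 0) \<alpha> t A" for \<alpha>
    proof (rule ccontr)
      assume "\<not> \<alpha> \<le> \<xi>"
      then have "osuc \<xi> \<le> \<alpha>" by (simp add: osuc_le_iff)
      with that \<xi>(2) show False using reach_mono by blast
    qed
    have bound1: "\<beta> \<le> \<zeta>" if "reach T (C 1) \<beta> t A" for \<beta>
    proof (rule ccontr)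
      assume "\<not> \<beta> \<le> \<zeta>"
      then have "osuc \<zeta> \<le> \<beta>" by (simp add: osuc_le_iff)
      with that \<zeta>(2) show False using reach_mono by blast
    qed
    have "\<eta> \<le> \<xi> \<oplus> \<zeta>"
    proof (rule ccontr)
      assume "\<not> \<eta> \<le> \<xi> \<oplus> \<zeta>"
      then have lt: "\<xi> \<oplus> \<zeta> < \<eta>" by simp
      with less.prems obtain u
        where u: "u \<in> T" "strict_prefix t u" "reach T (\<lambda>_. UNIV) (\<xi> \<oplus> \<zeta>) u A"
        by (rule reachE) simp
      have tu: "prefix t u" using u(2) by simp
      have "A \<inter> ends T u \<subseteq> (A \<inter> C 0 u) \<union> (A \<inter> C 1 u)"
        using col u(1) by (auto simp: coloring_def)
      from reach_split[OF u(3) this]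
      consider "reach T (\<lambda>_. UNIV) (\<xi> \<oplus> \<zeta>) u (A \<inter> C 0 u)"
        | "reach T (\<lambda>_. UNIV) (\<xi> \<oplus> \<zeta>) u (A \<inter> C 1 u)" by blast
      then show False
      proof cases
        case 1
        from less.IH[OF lt this] obtain \<alpha> \<beta>
          where ab: "reach T (C 0) \<alpha> u (A \<inter> C 0 u)" "reach T (C 1) \<beta> u (A \<inter> C 0 u)"
            "\<xi> \<oplus> \<zeta> \<le> \<alpha> \<oplus> \<beta>" by blast
        have "reach T (C 0) (osuc \<alpha>) t A" using u(1,2) ab(1) by (rule reach_osuc)
        then have "\<alpha> < \<xi>" unfolding osuc_le_iff[symmetric] by (rule bound0)
        moreover have "reach T (C 1) \<beta> t A" using reach_mono[OF ab(2) order.refl tu] by simp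
        then have "\<beta> \<le> \<zeta>" by (rule bound1)
        ultimately have "\<alpha> \<oplus> \<beta> < \<xi> \<oplus> \<zeta>"
          using natural_sum_less_left natural_sum_mono[OF order.refl] by (meson order.strict_trans1)
        with ab(3) show False by simp
      next
        case 2
        from less.IH[OF lt this] obtain \<alpha> \<beta>
          where ab: "reach T (C 0) \<alpha> u (A \<inter> C 1 u)" "reach T (C 1) \<beta> u (A \<inter> C 1 u)"
            "\<xi> \<oplus> \<zeta> \<le> \<alpha> \<oplus> \<beta>" by blast
        have "reach T (C 1) (osuc \<beta>) t A" using u(1,2) ab(2) by (rule reach_osuc)
        then have "\<beta> < \<zeta>" unfolding osuc_le_iff[symmetric] by (rule bound1)
        moreover have "reach T (C 0) \<alpha> t A" using reach_mono[OF ab(1) order.refl tu] by simp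
        then have "\<alpha> \<le> \<xi>" by (rule bound0)
        ultimately have "\<alpha> \<oplus> \<beta> < \<xi> \<oplus> \<zeta>"
          using natural_sum_less_right natural_sum_mono[OF _ order.refl] by (meson order.strict_trans2)
        with ab(3) show False by simp
      qed
    qed
    with \<xi>(1) \<zeta>(1) show ?thesis by blast
  qed
qed

text \<open>
  The three clauses for the derivatives in one formula: a node is removed at the first stage at
  which it is a leaf. In this form the derivatives obey the same recursion as the ordinary rank.
\<close>

lemma in_deriv_iff:
  "t \<in> deriv \<xi> T \<longleftrightarrow> t \<in> T \<and> (\<forall>\<zeta><\<xi>. \<exists>u\<in>deriv \<zeta> T. strict_prefix t u)"
proof (induction \<xi> rule: less_induct)
  case (less \<xi>)
  show ?case
  proof (cases \<xi> rule: ordinal_cases)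
    case (2 \<eta>)
    have "t \<in> deriv \<xi> T \<longleftrightarrow> t \<in> deriv \<eta> T \<and> (\<exists>u\<in>deriv \<eta> T. strict_prefix t u)"
      by (auto simp: 2 leaves_def)
    also have "\<dots> \<longleftrightarrow> t \<in> T \<and> (\<forall>\<zeta><osuc \<eta>. \<exists>u\<in>deriv \<zeta> T. strict_prefix t u)"
      using less[of \<eta>] by (auto simp: 2 less_osuc_iff le_less)
    finally show ?thesis by (simp only: 2)
  next
    case 3
    then have "0 < \<xi>" by (simp add: is_limit_def ordinal_pos_iff)
    have "t \<in> deriv \<xi> T \<longleftrightarrow> (\<forall>\<zeta><\<xi>. t \<in> deriv \<zeta> T)" by (auto simp: 3)
    also have "\<dots> \<longleftrightarrow> (\<forall>\<zeta><\<xi>. t \<in> T \<and> (\<forall>\<eta><\<zeta>. \<exists>u\<in>deriv \<eta> T. strict_prefix t u))"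
      using less by blast
    also have "\<dots> \<longleftrightarrow> t \<in> T \<and> (\<forall>\<eta><\<xi>. \<exists>u\<in>deriv \<eta> T. strict_prefix t u)"
      using \<open>0 < \<xi>\<close> osuc_less_limit[OF 3] less_osuc order.strict_trans by metis
    finally show ?thesis .
  qed simp
qed

text \<open>
  Nodes with no leaf above them would never be removed: none of them is a leaf, and the extensions
  of such a node are of the same kind.
\<close>

lemma ends_nonempty:
  assumes "wf_tree T" "t \<in> T"
  shows "ends T t \<noteq> {}"
proof
  assume "ends T t = {}"
  have "\<forall>t\<in>T. ends T t = {} \<longrightarrow> t \<in> deriv \<xi> T" for \<xi> :: "'a ordinal"
  proof (induction \<xi> rule: less_induct)
    case (less \<xi>)
    show ?case
    proof (intro ballI impI)
      fix t assume t: "t \<in> T" "ends T t = {}"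
      then have "t \<notin> leaves T" by (auto simp: ends_def)
      with t obtain u where u: "u \<in> T" "strict_prefix t u" by (auto simp: leaves_def)
      have "ends T u = {}" using ends_antimono[of t u T] u(2) t(2) by auto
      with less u t(1) show "t \<in> deriv \<xi> T" unfolding in_deriv_iff[of t] by blast
    qed
  qed
  with \<open>ends T t = {}\<close> assms show False by (auto simp: wf_tree_def)
qed

lemma deriv_reach:
  assumes "wf_tree T"
  shows "t \<in> deriv \<xi> T \<Longrightarrow> reach T (\<lambda>_. UNIV) \<xi> t UNIV"
proof (induction \<xi> arbitrary: t rule: less_induct)
  case (less \<xi>)
  then have t: "t \<in> T" "\<And>\<zeta>. \<zeta> < \<xi> \<Longrightarrow> \<exists>u\<in>deriv \<zeta> T. strict_prefix t u"
    unfolding in_deriv_iff[of t] by blast+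
  show ?case
  proof (rule reachI)
    show "UNIV \<inter> ends T t \<noteq> {}" using ends_nonempty[OF assms t(1)] by simp
  next
    fix \<zeta> assume "\<zeta> < \<xi>"
    then obtain u where u: "u \<in> deriv \<zeta> T" "strict_prefix t u" using t(2) by blast
    moreover have "u \<in> T" using u(1) in_deriv_iff by blast
    ultimately show "\<exists>u\<in>T. strict_prefix t u \<and> reach T (\<lambda>_. UNIV) \<zeta> u (UNIV \<inter> UNIV)"
      using less.IH[OF \<open>\<zeta> < \<xi>\<close>] by auto
  qed
qed

lemma tree_order_reach:
  assumes "wf_tree T" "[] \<notin> T" "T \<noteq> {}"
  shows "reach T (\<lambda>_. UNIV) (tree_order T) [] UNIV"
proof (rule reachI)
  obtain t where "t \<in> T" using assms(3) by blast
  then show "UNIV \<inter> ends T [] \<noteq> {}"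
    using ends_nonempty[OF assms(1)] ends_antimono[of "[]" t T] by auto
next
  fix \<zeta> assume "\<zeta> < tree_order T"
  then have "deriv \<zeta> T \<noteq> {}" unfolding tree_order_def by (rule not_less_Least)
  then obtain u where u: "u \<in> deriv \<zeta> T" by blast
  then have "u \<in> T" using in_deriv_iff by blast
  moreover from this have "strict_prefix [] u" using assms(2) by (cases u) auto
  ultimately show "\<exists>u\<in>T. strict_prefix [] u \<and> reach T (\<lambda>_. UNIV) \<zeta> u (UNIV \<inter> UNIV)"
    using deriv_reach[OF assms(1) u] by auto
qed

section \<open>Minimal trees and their embeddings\<close>

lemma MT_prefix: "s \<in> MT \<xi> \<Longrightarrow> prefix r s \<Longrightarrow> r \<in> MT \<xi>"
proof (induction \<xi> arbitrary: r s rule: less_induct)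
  case (less \<xi>)
  show ?case
  proof (cases \<xi> rule: ordinal_cases)
    case 1
    with less.prems show ?thesis by simp
  next
    case (2 \<zeta>)
    then have "\<zeta> < \<xi>" by simp
    show ?thesis
    proof (cases r)
      case (Cons x r')
      with less.prems obtain s' where s': "s' \<in> MT \<zeta>" "prefix r' s'" "x = osuc \<zeta>"
        unfolding 2 by auto
      from less.IH[OF \<open>\<zeta> < \<xi>\<close> s'(1,2)] show ?thesis by (simp add: 2 Cons s'(3))
    qed (simp add: 2)
  next
    case 3
    from less.prems(1) obtain \<zeta> where \<zeta>: "\<zeta> < \<xi>" "s \<in> MT (osuc \<zeta>)"
      unfolding MT.simps(3)[OF 3] by blast
    have "r \<in> MT (osuc \<zeta>)"
      using osuc_less_limit[OF 3 \<zeta>(1)] \<zeta>(2) less.prems(2) by (rule less.IH)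
    with \<zeta>(1) show ?thesis unfolding MT.simps(3)[OF 3] by blast
  qed
qed

lemma Nil_in_MT: "[] \<in> MT \<xi>"
proof (cases \<xi> rule: ordinal_cases)
  case 3
  then have "0 < \<xi>" by (simp add: is_limit_def ordinal_pos_iff)
  with 3 show ?thesis by auto
qed simp_all

lemma min_tree_prefix:
  "s \<in> min_tree \<xi> \<Longrightarrow> prefix r s \<Longrightarrow> r \<noteq> [] \<Longrightarrow> r \<in> min_tree \<xi>"
  unfolding min_tree_def using MT_prefix[of s \<xi> r] by simp

lemma min_tree_zero [simp]: "min_tree 0 = {}"
  by (simp add: min_tree_def)

lemma min_tree_osuc: "min_tree (osuc \<zeta>) = (#) (osuc \<zeta>) ` insert [] (min_tree \<zeta>)"
proof -
  have "insert [] (min_tree \<zeta>) = MT \<zeta>" using Nil_in_MT[of \<zeta>] by (auto simp: min_tree_def)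
  then show ?thesis by (auto simp: min_tree_def)
qed

lemma min_tree_limit_iff:
  assumes "is_limit \<xi>"
  shows "s \<in> min_tree \<xi> \<longleftrightarrow> (\<exists>\<zeta><\<xi>. s \<in> min_tree (osuc \<zeta>))"
  unfolding min_tree_def MT.simps(3)[OF assms] by blast

lemma leaves_min_tree_osuc:
  assumes "s \<in> leaves (min_tree (osuc \<zeta>))"
  obtains s' where "s = osuc \<zeta> # s'" "s' = [] \<or> s' \<in> leaves (min_tree \<zeta>)"
proof -
  from assms obtain s' where s': "s = osuc \<zeta> # s'" "s' = [] \<or> s' \<in> min_tree \<zeta>"
    by (auto simp: leaves_def min_tree_osuc)
  have "\<not> strict_prefix s' r" if "r \<in> min_tree \<zeta>" for r
  proof
    assume "strict_prefix s' r"
    then have "strict_prefix s (osuc \<zeta> # r)" by (simp add: s')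
    moreover have "osuc \<zeta> # r \<in> min_tree (osuc \<zeta>)" using that by (simp add: min_tree_osuc)
    ultimately show False using assms by (auto simp: leaves_def)
  qed
  with s' that show thesis by (auto simp: leaves_def)
qed

text \<open>
  Monochromaticity of the induced coloring is expressed through the nodes \<open>r \<preceq> s\<close> of \<open>S\<close>
  instead of the lengths of initial segments. The image lies strictly above \<open>t\<close>, and the leaves are
  chosen from \<open>A\<close>; these two conditions make an induction on the minimal tree possible.
\<close>

definition embeds ::
  "'b list set \<Rightarrow> 'a list set \<Rightarrow> ('a list \<Rightarrow> 'a list set) \<Rightarrow> 'a list \<Rightarrow> 'a list set \<Rightarrow>
     ('b list \<Rightarrow> 'a list) \<Rightarrow> ('b list \<Rightarrow> 'a list) \<Rightarrow> bool" where
  "embeds S T K t A i e \<longleftrightarrow> ext_order_preserving S T i e \<and> (\<forall>s\<in>S. strict_prefix t (i s)) \<and>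
     (\<forall>s\<in>leaves S. e s \<in> A \<and> (\<forall>r\<in>S. prefix r s \<longrightarrow> e s \<in> K (i r)))"

text \<open>
  The minimal tree of order \<open>\<zeta> + 1\<close> is that of order \<open>\<zeta>\<close> with a new root; the root is sent to \<open>u\<close>
  and the rest is mapped as before. The leaf \<open>x\<close> matters only for \<open>\<zeta> = 0\<close>, when the root is itself
  a leaf.
\<close>

lemma embeds_cons:
  assumes emb: "embeds (min_tree \<zeta>) T K u (A \<inter> K u) i e"
    and u: "u \<in> T" "strict_prefix t u" and x: "x \<in> A \<inter> K u \<inter> ends T u"
  defines "i' \<equiv> \<lambda>s. if tl s = [] then u else i (tl s)"
    and "e' \<equiv> \<lambda>s. if tl s = [] then x else e (tl s)"
  shows "embeds (min_tree (osuc \<zeta>)) T K t A i' e'"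
proof -
  have nonempty: "s \<noteq> []" if "s \<in> min_tree \<zeta>" for s using that by (auto simp: min_tree_def)
  have leafD: "s \<in> min_tree \<zeta>" if "s \<in> leaves (min_tree \<zeta>)" for s
    using that by (auto simp: leaves_def)
  have i: "i s \<in> T" "strict_prefix u (i s)" if "s \<in> min_tree \<zeta>" for s
    using emb that by (auto simp: embeds_def ext_order_preserving_def order_preserving_def)
  have ii: "strict_prefix (i r) (i s)"
    if "r \<in> min_tree \<zeta>" "s \<in> min_tree \<zeta>" "strict_prefix r s" for r s
    using emb that by (auto simp: embeds_def ext_order_preserving_def order_preserving_def)
  have e: "e s \<in> leaves T" "prefix (i s) (e s)" "e s \<in> A" "e s \<in> K u"
    if "s \<in> leaves (min_tree \<zeta>)" for s
    using emb that by (auto simp: embeds_def ext_order_preserving_def)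
  have eK: "e s \<in> K (i r)"
    if "s \<in> leaves (min_tree \<zeta>)" "r \<in> min_tree \<zeta>" "prefix r s" for r s
    using emb that by (auto simp: embeds_def)
  have x': "x \<in> A" "x \<in> K u" "x \<in> leaves T" "prefix u x" using x by (auto simp: ends_def)
  show ?thesis
    unfolding embeds_def ext_order_preserving_def order_preserving_def
  proof (intro conjI ballI impI)
    show "i' ` min_tree (osuc \<zeta>) \<subseteq> T"
      using u i by (auto simp: i'_def min_tree_osuc)
    show "strict_prefix (i' r) (i' s)"
      if "r \<in> min_tree (osuc \<zeta>)" "s \<in> min_tree (osuc \<zeta>)" "strict_prefix r s" for r s
      using that i ii nonempty by (auto simp: i'_def min_tree_osuc)
    show "e' ` leaves (min_tree (osuc \<zeta>)) \<subseteq> leaves T"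
      using x' e by (auto simp: e'_def elim!: leaves_min_tree_osuc)
    show "strict_prefix t (i' s)" if "s \<in> min_tree (osuc \<zeta>)" for s
      using that u(2) i prefix_order.less_trans[OF u(2)] by (auto simp: i'_def min_tree_osuc)
    fix s assume s: "s \<in> leaves (min_tree (osuc \<zeta>))"
    show "prefix (i' s) (e' s)"
      using s x' e by (auto simp: e'_def i'_def elim!: leaves_min_tree_osuc)
    show "e' s \<in> A"
      using s x' e by (auto simp: e'_def elim!: leaves_min_tree_osuc)
    fix r assume r: "r \<in> min_tree (osuc \<zeta>)" "prefix r s"
    obtain r' where r': "r = osuc \<zeta> # r'" "r' = [] \<or> r' \<in> min_tree \<zeta>"
      using r(1) by (auto simp: min_tree_osuc)
    from s show "e' s \<in> K (i' r)"
    proof (rule leaves_min_tree_osuc)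
      fix s' assume s': "s = osuc \<zeta> # s'" "s' = [] \<or> s' \<in> leaves (min_tree \<zeta>)"
      have "prefix r' s'" using r(2) by (simp add: r' s')
      then show ?thesis
        using r'(2) s'(2) x'(2) e(4) eK nonempty leafD by (auto simp: i'_def e'_def r'(1) s'(1))
    qed
  qed
qed

text \<open>
  At a limit the minimal tree is a disjoint union, and the first entry of a sequence tells to
  which of the parts it belongs. The maps for the parts are therefore simply put together.
\<close>

lemma embeds_limit:
  assumes lim: "is_limit \<xi>"
    and emb: "\<And>\<zeta>. \<zeta> < \<xi> \<Longrightarrow> embeds (min_tree \<zeta>) T K t A (I \<zeta>) (E \<zeta>)"
  shows "embeds (min_tree \<xi>) T K t A (\<lambda>s. I (hd s) s) (\<lambda>s. E (hd s) s)"
proof -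
  have hd: "hd s < \<xi> \<and> s \<in> min_tree (hd s) \<and> s \<noteq> []" if "s \<in> min_tree \<xi>" for s
    using that osuc_less_limit[OF lim] by (auto simp: min_tree_limit_iff[OF lim] min_tree_osuc)
  have leaf: "s \<in> leaves (min_tree (hd s)) \<and> s \<in> min_tree \<xi>" if "s \<in> leaves (min_tree \<xi>)" for s
  proof -
    have s: "s \<in> min_tree \<xi>" using that by (simp add: leaves_def)
    then obtain \<zeta> where \<zeta>: "\<zeta> < \<xi>" "s \<in> min_tree (osuc \<zeta>)"
      by (auto simp: min_tree_limit_iff[OF lim])
    then have "hd s = osuc \<zeta>" by (auto simp: min_tree_osuc)
    moreover have "min_tree (osuc \<zeta>) \<subseteq> min_tree \<xi>"
      using \<zeta> by (auto simp: min_tree_limit_iff[OF lim])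
    ultimately show ?thesis using that \<zeta> s by (auto simp: leaves_def)
  qed
  have hd_eq: "hd s = hd r" if "prefix r s" "r \<in> min_tree \<xi>" for r s
    using that hd by (auto simp: prefix_def)
  have I: "I (hd s) s \<in> T" "strict_prefix t (I (hd s) s)" if "s \<in> min_tree \<xi>" for s
    using emb[of "hd s"] hd[OF that]
    by (auto simp: embeds_def ext_order_preserving_def order_preserving_def)
  have II: "strict_prefix (I (hd r) r) (I (hd s) s)"
    if "r \<in> min_tree \<xi>" "s \<in> min_tree \<xi>" "strict_prefix r s" for r s
  proof -
    have "hd s = hd r" using that by (intro hd_eq) auto
    with emb[of "hd r"] hd[OF that(1)] hd[OF that(2)] that(3) show ?thesis
      by (auto simp: embeds_def ext_order_preserving_def order_preserving_def)
  qed
  have E: "E (hd s) s \<in> leaves T" "prefix (I (hd s) s) (E (hd s) s)" "E (hd s) s \<in> A"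
    if "s \<in> leaves (min_tree \<xi>)" for s
    using emb[of "hd s"] leaf[OF that] hd[of s]
    by (auto simp: embeds_def ext_order_preserving_def)
  have EK: "E (hd s) s \<in> K (I (hd r) r)"
    if "s \<in> leaves (min_tree \<xi>)" "r \<in> min_tree \<xi>" "prefix r s" for r s
  proof -
    have "hd s = hd r" using that by (intro hd_eq)
    with emb[of "hd r"] leaf[OF that(1)] hd[OF that(2)] that(3) show ?thesis
      by (auto simp: embeds_def)
  qed
  show ?thesis
    unfolding embeds_def ext_order_preserving_def order_preserving_def
  proof (intro conjI ballI impI image_subsetI)
    show "I (hd s) s \<in> T" "strict_prefix t (I (hd s) s)" if "s \<in> min_tree \<xi>" for s
      using that by (rule I)+
    show "strict_prefix (I (hd r) r) (I (hd s) s)"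
      if "r \<in> min_tree \<xi>" "s \<in> min_tree \<xi>" "strict_prefix r s" for r s
      using that by (rule II)
    fix s assume s: "s \<in> leaves (min_tree \<xi>)"
    then show "E (hd s) s \<in> leaves T" "prefix (I (hd s) s) (E (hd s) s)" "E (hd s) s \<in> A"
      by (rule E)+
    show "E (hd s) s \<in> K (I (hd r) r)" if "r \<in> min_tree \<xi>" "prefix r s" for r
      using s that by (rule EK)
  qed
qed

lemma reach_embeds: "reach T K \<xi> t A \<Longrightarrow> \<exists>i e. embeds (min_tree \<xi>) T K t A i e"
proof (induction \<xi> arbitrary: t A rule: less_induct)
  case (less \<xi>)
  show ?case
  proof (cases \<xi> rule: ordinal_cases)
    case 1
    then show ?thesis
      by (simp add: embeds_def ext_order_preserving_def order_preserving_def leaves_def)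
  next
    case (2 \<zeta>)
    then have "\<zeta> < \<xi>" by simp
    with less.prems obtain u where u: "u \<in> T" "strict_prefix t u" "reach T K \<zeta> u (A \<inter> K u)"
      by (rule reachE)
    from less.IH[OF \<open>\<zeta> < \<xi>\<close> u(3)] obtain i e
      where "embeds (min_tree \<zeta>) T K u (A \<inter> K u) i e" by blast
    moreover obtain x where "x \<in> A \<inter> K u \<inter> ends T u" using reach_ends[OF u(3)] by blast
    ultimately show ?thesis unfolding 2 using embeds_cons u(1,2) by blast
  next
    case 3
    have "\<exists>i e. embeds (min_tree \<zeta>) T K t A i e" if "\<zeta> < \<xi>" for \<zeta>
      using less.IH[OF that] reach_mono[OF less.prems, of \<zeta>] that by simp
    then obtain I E where "\<And>\<zeta>. \<zeta> < \<xi> \<Longrightarrow> embeds (min_tree \<zeta>) T K t A (I \<zeta>) (E \<zeta>)"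
      by metis
    from embeds_limit[OF 3 this] show ?thesis by blast
  qed
qed

lemma embeds_monochromatic:
  assumes "embeds (min_tree \<xi>) T (C j) t A i e"
  shows "monochromatic (min_tree \<xi>) (induced_coloring (min_tree \<xi>) i e C) j"
  unfolding monochromatic_def
proof (intro ballI INT_I)
  fix s k assume s: "s \<in> leaves (min_tree \<xi>)" and k: "k \<in> {1..length s}"
  have "s \<in> min_tree \<xi>" using s by (simp add: leaves_def)
  moreover have "take k s \<noteq> []" using k by (cases s; cases k) simp_all
  ultimately have "take k s \<in> min_tree \<xi>"
    by (rule min_tree_prefix[OF _ take_is_prefix])
  then have "e s \<in> C j (i (take k s))"
    using assms s take_is_prefix[of k s] by (simp add: embeds_def)
  then show "s \<in> induced_coloring (min_tree \<xi>) i e C j (take k s)"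
    using s by (simp add: induced_coloring_def ends_def take_is_prefix)
qed

theorem lemma3p7:
  fixes T :: "'a list set" and C :: "nat \<Rightarrow> 'a list \<Rightarrow> 'a list set"
  assumes "B_tree T" and "wf_tree T" and "coloring T C"
  shows "\<exists>\<xi> :: nat \<Rightarrow> 'a ordinal.
           (\<forall>j\<in>{0, 1}. \<exists>i e. ext_order_preserving (min_tree (\<xi> j)) T i e
              \<and> monochromatic (min_tree (\<xi> j)) (induced_coloring (min_tree (\<xi> j)) i e C) j)
           \<and> \<xi> 0 \<oplus> \<xi> 1 = tree_order T"
proof -
  obtain \<xi>\<^sub>0 \<xi>\<^sub>1 :: "'a ordinal"
    where sum: "\<xi>\<^sub>0 \<oplus> \<xi>\<^sub>1 = tree_order T"
      and emb: "\<exists>i e. embeds (min_tree \<xi>\<^sub>0) T (C 0) [] UNIV i e"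
        "\<exists>i e. embeds (min_tree \<xi>\<^sub>1) T (C 1) [] UNIV i e"
  proof (cases "T = {}")
    case True
    then have "tree_order T \<le> (0 :: 'a ordinal)"
      unfolding tree_order_def by (intro Least_le) simp
    then have "0 \<oplus> 0 = (tree_order T :: 'a ordinal)" by (simp add: order.antisym)
    then show thesis
      by (rule that) (simp_all add: embeds_def ext_order_preserving_def order_preserving_def leaves_def)
  next
    case False
    then have "reach T (\<lambda>_. UNIV) (tree_order T) [] UNIV"
      using assms by (intro tree_order_reach) (simp_all add: B_tree_def)
    from reach_colors[OF assms(3) this] obtain \<xi> \<zeta> :: "'a ordinal"
      where r: "reach T (C 0) \<xi> [] UNIV" "reach T (C 1) \<zeta> [] UNIV" "tree_order T \<le> \<xi> \<oplus> \<zeta>"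
      by blast
    from r(3) obtain \<xi>' \<zeta>' where le: "\<xi>' \<le> \<xi>" "\<zeta>' \<le> \<zeta>" and eq: "\<xi>' \<oplus> \<zeta>' = tree_order T"
      by (rule natural_sum_exact)
    have "reach T (C 0) \<xi>' [] UNIV" "reach T (C 1) \<zeta>' [] UNIV"
      using reach_mono[OF r(1) le(1)] reach_mono[OF r(2) le(2)] by simp_all
    then show thesis using reach_embeds that[OF eq] by blast
  qed
  define \<xi> where "\<xi> = (\<lambda>j :: nat. if j = 0 then \<xi>\<^sub>0 else \<xi>\<^sub>1)"
  have "\<exists>i e. ext_order_preserving (min_tree (\<xi> j)) T i e
      \<and> monochromatic (min_tree (\<xi> j)) (induced_coloring (min_tree (\<xi> j)) i e C) j"
    if "j \<in> {0, 1}" for j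
  proof -
    have "\<exists>i e. embeds (min_tree (\<xi> j)) T (C j) [] UNIV i e"
      using that emb by (auto simp: \<xi>_def)
    then obtain i e where "embeds (min_tree (\<xi> j)) T (C j) [] UNIV i e" by blast
    from embeds_monochromatic[of "\<xi> j" T C j "[]" UNIV i e] this show ?thesis
      unfolding embeds_def by blast
  qed
  moreover have "\<xi> 0 \<oplus> \<xi> 1 = tree_order T" using sum by (simp add: \<xi>_def)
  ultimately show ?thesis by blast
qed

end
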